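(* Let $T$ be a consistent RE theory and $n\ge1$. If $T$ is effectively $n$-Rosser, then $T$ is effectively exact $n$-Rosser.
   Context: A fixed Gödel numbering of formulas is used. ${\sf Num}$ is the theory in the language $\{\mathbf 0,\mathbf S\}$ with axioms $\overline m\neq\overline n$ for $m\neq n$, where $\overline 0=\mathbf 0$, $\overline{k+1}=\mathbf S\overline k$. An interpretation $I:{\sf Num}\unlhd T$ is a translation of the language of ${\sf Num}$ into that of $T$ such that $T$ proves totality of translated function symbols on the domain, the translations of all theorems of ${\sf Num}$ and of the equality axioms; $\overline a^I$ is the $I$-translation of $\overline a$. If $T$ is a relational extension of ${\sf Num}$, $I$ is taken to be the identity. $\langle R^n_i\rangle$ is an acceptable enumeration of $n$-ary RE relations. A formula $\phi(x_1,\dots,x_n)$ with exactly $n$ free variables strongly separates $M_1$ from $M_2$ in $T$ w.r.t. $I$ if $\vec a\in M_1\Rightarrow T\vdash\phi(\overline{a_1}^I,\dots,\overline{a_n}^I)$ and $\vec a\in M_2\Rightarrow T\vdash\neg\phi(\overline{a_1}^I,\dots,\overline{a_n}^I)$; for disjoint $M_1,M_2$ it exactly separates them if both are equivalences. $T$ is effectively $n$-Rosser if there are $I:{\sf Num}\unlhd T$ and a recursive $f$ such that for all $i,j$, $f(i,j)$ is the code of a formula with exactly $n$ free variables strongly separating $R^n_i\setminus R^n_j$ from $R^n_j\setminus R^n_i$ w.r.t. $I$. $T$ is effectively exact $n$-Rosser if there are $I$ and a recursive $f$ such that for all $i,j$ with $R^n_i\cap R^n_j=\emptyset$, $f(i,j)$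 codes a formula with exactly $n$ free variables exactly separating $R^n_i$ from $R^n_j$ w.r.t. $I$. *)

theory Defs
  imports Main "HOL-Library.Nat_Bijection"
begin

section \<open>Recursive functions and RE relations\<close>

text \<open>
  A \<open>k\<close>-ary function is a function on lists of which only the values on lists of length \<open>k\<close>
  matter (rule \<open>ext\<close>).  The total recursive functions are the least class containing the
  initial functions and closed under composition, primitive recursion and minimisation of
  regular functions.
\<close>

inductive recursive :: "nat \<Rightarrow> (nat list \<Rightarrow> nat) \<Rightarrow> bool" where
  zero: "recursive k (\<lambda>xs. 0)"
| succ: "recursive 1 (\<lambda>xs. Suc (xs ! 0))"
| proj: "i < k \<Longrightarrow> recursive k (\<lambda>xs. xs ! i)"
| comp: "recursive (length hs) g \<Longrightarrow> (\<And>h. h \<in> set hs \<Longrightarrow> recursive k h)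
    \<Longrightarrow> recursive k (\<lambda>xs. g (map (\<lambda>h. h xs) hs))"
| prim_rec: "recursive k g \<Longrightarrow> recursive (Suc (Suc k)) h
    \<Longrightarrow> recursive (Suc k) (\<lambda>xs. rec_nat (g (tl xs)) (\<lambda>y r. h (y # r # tl xs)) (hd xs))"
| minim: "recursive (Suc k) g \<Longrightarrow> (\<And>xs. length xs = k \<Longrightarrow> \<exists>y. g (y # xs) = 0)
    \<Longrightarrow> recursive k (\<lambda>xs. LEAST y. g (y # xs) = 0)"
| ext: "recursive k f \<Longrightarrow> (\<And>xs. length xs = k \<Longrightarrow> f xs = g xs) \<Longrightarrow> recursive k g"

definition RE :: "nat \<Rightarrow> nat list set \<Rightarrow> bool" where
  "RE n A \<longleftrightarrow> (\<exists>f. recursive (Suc n) f \<and> A = {xs. length xs = n \<and> (\<exists>y. f (y # xs) = 0)})"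

text \<open>
  Acceptable enumerations of the \<open>n\<close>-ary RE relations: all of them are listed, and
  the enumeration theorem and the s-m-n (parametrisation) theorem hold.
\<close>

definition acceptable_enumeration :: "nat \<Rightarrow> (nat \<Rightarrow> nat list set) \<Rightarrow> bool" where
  "acceptable_enumeration n R \<longleftrightarrow>
     range R = {A. RE n A} \<and>
     RE (Suc n) {i # xs | i xs. xs \<in> R i} \<and>
     (\<forall>A. RE (Suc n) A \<longrightarrow> (\<exists>g. recursive 1 g \<and> (\<forall>x. R (g [x]) = {xs. x # xs \<in> A})))"


section \<open>First-order logic with identity\<close>

text \<open>
  Variables are de Bruijn indices.  A symbol is a name together with an arity; the
  arity is read off from the number of arguments.
\<close>

datatype tm = Var nat | Fun nat "tm list"

datatype fm = Eq tm tm | Rel nat "tm list" | Bot | Imp fm fm | All fm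

abbreviation Neg :: "fm \<Rightarrow> fm" where "Neg p \<equiv> Imp p Bot"
abbreviation Conj :: "fm \<Rightarrow> fm \<Rightarrow> fm" where "Conj p q \<equiv> Neg (Imp p (Neg q))"
abbreviation Ex :: "fm \<Rightarrow> fm" where "Ex p \<equiv> Neg (All (Neg p))"

fun fv_tm :: "tm \<Rightarrow> nat set" where
  "fv_tm (Var i) = {i}"
| "fv_tm (Fun f ts) = (\<Union>t \<in> set ts. fv_tm t)"

primrec fv :: "fm \<Rightarrow> nat set" where
  "fv (Eq s t) = fv_tm s \<union> fv_tm t"
| "fv (Rel r ts) = (\<Union>t \<in> set ts. fv_tm t)"
| "fv Bot = {}"
| "fv (Imp p q) = fv p \<union> fv q"
| "fv (All p) = {i. Suc i \<in> fv p}"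

primrec subst_tm :: "(nat \<Rightarrow> tm) \<Rightarrow> tm \<Rightarrow> tm" where
  "subst_tm \<sigma> (Var i) = \<sigma> i"
| "subst_tm \<sigma> (Fun f ts) = Fun f (map (subst_tm \<sigma>) ts)"

abbreviation shift :: "nat \<Rightarrow> tm" where "shift \<equiv> \<lambda>i. Var (Suc i)"

primrec subst :: "(nat \<Rightarrow> tm) \<Rightarrow> fm \<Rightarrow> fm" where
  "subst \<sigma> (Eq s t) = Eq (subst_tm \<sigma> s) (subst_tm \<sigma> t)"
| "subst \<sigma> (Rel r ts) = Rel r (map (subst_tm \<sigma>) ts)"
| "subst \<sigma> Bot = Bot"
| "subst \<sigma> (Imp p q) = Imp (subst \<sigma> p) (subst \<sigma> q)"
| "subst \<sigma> (All p) = All (subst (case_nat (Var 0) (\<lambda>i. subst_tm shift (\<sigma> i))) p)"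

abbreviation inst0 :: "tm \<Rightarrow> fm \<Rightarrow> fm" where "inst0 t \<equiv> subst (case_nat t Var)"

text \<open>
  Hilbert calculus.  Theories are axiomatised by sentences, so generalisation needs no side
  condition.  Derivations may use symbols outside the language of the theory; by
  conservativity this proves no more formulas of that language.
\<close>

inductive derivable :: "fm set \<Rightarrow> fm \<Rightarrow> bool" for A where
  axm: "p \<in> A \<Longrightarrow> derivable A p"
| prop_K: "derivable A (Imp p (Imp q p))"
| prop_S: "derivable A (Imp (Imp p (Imp q r)) (Imp (Imp p q) (Imp p r)))"
| prop_DN: "derivable A (Imp (Neg (Neg p)) p)"
| all_inst: "derivable A (Imp (All p) (inst0 t p))"
| all_dist: "derivable A (Imp (All (Imp p q)) (Imp (All p) (All q)))"
| all_vac: "derivable A (Imp p (All (subst shift p)))"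
| eq_refl: "derivable A (Eq t t)"
| eq_subst: "derivable A (Imp (Eq s t) (Imp (inst0 s p) (inst0 t p)))"
| mp: "derivable A (Imp p q) \<Longrightarrow> derivable A p \<Longrightarrow> derivable A q"
| gen: "derivable A p \<Longrightarrow> derivable A (All p)"


section \<open>Goedel numbering\<close>

primrec tm_code :: "tm \<Rightarrow> nat" where
  "tm_code (Var i) = list_encode [0, i]"
| "tm_code (Fun f ts) = list_encode (1 # f # map tm_code ts)"

primrec fm_code :: "fm \<Rightarrow> nat" where
  "fm_code (Eq s t) = list_encode [0, tm_code s, tm_code t]"
| "fm_code (Rel r ts) = list_encode (1 # r # map tm_code ts)"
| "fm_code Bot = list_encode [2]"
| "fm_code (Imp p q) = list_encode [3, fm_code p, fm_code q]"
| "fm_code (All p) = list_encode [4, fm_code p]"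

lemma tm_code_inject: "tm_code s = tm_code t \<Longrightarrow> s = t"
proof (induction s arbitrary: t)
  case (Var i)
  then show ?case by (cases t) (auto simp: list_encode_eq simp del: list_encode.simps)
next
  case (Fun f ss)
  then obtain ts where t: "t = Fun f ts" and ts: "map tm_code ss = map tm_code ts"
    by (cases t) (auto simp: list_encode_eq simp del: list_encode.simps)
  from ts have len: "length ss = length ts" by (metis length_map)
  have "ss ! i = ts ! i" if "i < length ss" for i
    using Fun.IH[of "ss ! i" "ts ! i"] that ts len by (metis nth_map nth_mem)
  with len t show ?case by (simp add: list_eq_iff_nth_eq)
qed

lemma inj_tm_code: "inj tm_code"
  by (rule injI) (rule tm_code_inject)

lemma inj_fm_code: "inj fm_code"
proof (rule injI)
  fix p q show "fm_code p = fm_code q \<Longrightarrow> p = q"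
  proof (induction p arbitrary: q)
    case (Eq s t) then show ?case
      by (cases q) (auto simp: list_encode_eq dest: tm_code_inject simp del: list_encode.simps)
  next
    case (Rel r ts) then show ?case
      by (cases q) (auto simp: list_encode_eq inj_map_eq_map[OF inj_tm_code]
          simp del: list_encode.simps)
  next
    case Bot then show ?case
      by (cases q) (auto simp: list_encode_eq simp del: list_encode.simps)
  next
    case (Imp p1 p2) then show ?case
      by (cases q) (auto simp: list_encode_eq simp del: list_encode.simps)
  next
    case (All p) then show ?case
      by (cases q) (auto simp: list_encode_eq simp del: list_encode.simps)
  qed
qed


section \<open>Theories\<close>

text \<open>Function and relation symbols, as pairs of name and arity.\<close>

record lang =
  funs :: "(nat \<times> nat) set"
  rels :: "(nat \<times> nat) set"

fun tm_in :: "lang \<Rightarrow> tm \<Rightarrow> bool" where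
  "tm_in L (Var i) \<longleftrightarrow> True"
| "tm_in L (Fun f ts) \<longleftrightarrow> (f, length ts) \<in> funs L \<and> (\<forall>t \<in> set ts. tm_in L t)"

primrec fm_in :: "lang \<Rightarrow> fm \<Rightarrow> bool" where
  "fm_in L (Eq s t) \<longleftrightarrow> tm_in L s \<and> tm_in L t"
| "fm_in L (Rel r ts) \<longleftrightarrow> (r, length ts) \<in> rels L \<and> (\<forall>t \<in> set ts. tm_in L t)"
| "fm_in L Bot \<longleftrightarrow> True"
| "fm_in L (Imp p q) \<longleftrightarrow> fm_in L p \<and> fm_in L q"
| "fm_in L (All p) \<longleftrightarrow> fm_in L p"

definition sentence_in :: "lang \<Rightarrow> fm \<Rightarrow> bool" where
  "sentence_in L p \<longleftrightarrow> fm_in L p \<and> fv p = {}"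

record thy =
  lang_of :: lang
  axioms :: "fm set"

abbreviation proves :: "thy \<Rightarrow> fm \<Rightarrow> bool" (infix \<open>\<turnstile>\<close> 50) where
  "T \<turnstile> p \<equiv> derivable (axioms T) p"

definition consistent :: "thy \<Rightarrow> bool" where
  "consistent T \<longleftrightarrow> \<not> T \<turnstile> Bot"

definition RE_theory :: "thy \<Rightarrow> bool" where
  "RE_theory T \<longleftrightarrow>
     (\<forall>p \<in> axioms T. sentence_in (lang_of T) p) \<and> RE 1 {[fm_code p] | p. p \<in> axioms T}"


section \<open>The theory Num and its interpretations\<close>

text \<open>The function symbols \<open>(0,0)\<close> and \<open>(1,1)\<close> play the role of zero and successor.\<close>

abbreviation Zero :: tm where "Zero \<equiv> Fun 0 []"
abbreviation Succ :: "tm \<Rightarrow> tm" where "Succ t \<equiv> Fun 1 [t]"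

primrec numeral_tm :: "nat \<Rightarrow> tm" where
  "numeral_tm 0 = Zero"
| "numeral_tm (Suc k) = Succ (numeral_tm k)"

definition Num :: thy where
  "Num = \<lparr>lang_of = \<lparr>funs = {(0,0), (1,1)}, rels = {}\<rparr>,
          axioms = {Neg (Eq (numeral_tm m) (numeral_tm n)) | m n. m \<noteq> n}\<rparr>"

definition eq_axioms :: "fm set" where
  "eq_axioms =
    {All (Eq (Var 0) (Var 0)),
     All (All (Imp (Eq (Var 1) (Var 0)) (Eq (Var 0) (Var 1)))),
     All (All (All (Imp (Eq (Var 2) (Var 1)) (Imp (Eq (Var 1) (Var 0)) (Eq (Var 2) (Var 0)))))),
     All (All (Imp (Eq (Var 1) (Var 0)) (Eq (Succ (Var 1)) (Succ (Var 0)))))}"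

text \<open>
  A (one-dimensional, parameter-free) translation of the language of Num: formulas
  \<open>\<delta>(x\<^sub>0)\<close> for the domain, \<open>E(x\<^sub>0,x\<^sub>1)\<close> for equality, \<open>Z(x\<^sub>0)\<close> for
  \<open>0 = x\<^sub>0\<close> and \<open>S(x\<^sub>0,x\<^sub>1)\<close> for \<open>S x\<^sub>0 = x\<^sub>1\<close>.
\<close>

record translation =
  domF :: fm
  eqF :: fm
  zeroF :: fm
  sucF :: fm

definition at1 :: "fm \<Rightarrow> nat \<Rightarrow> fm" where
  "at1 p i = subst (\<lambda>_. Var i) p"

definition at2 :: "fm \<Rightarrow> nat \<Rightarrow> nat \<Rightarrow> fm" where
  "at2 p i j = subst (case_nat (Var i) (\<lambda>_. Var j)) p"

text \<open>
  \<open>tr_tm I \<rho> t y\<close> translates \<open>t[\<rho>] = x\<^sub>y\<close>, where \<open>\<rho>\<close> renames the variables of \<open>t\<close>;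
  nested successors are unravelled by quantifiers over the domain.  Only terms of the
  language of Num are meant, so function names are not inspected.
\<close>

fun tr_tm :: "translation \<Rightarrow> (nat \<Rightarrow> nat) \<Rightarrow> tm \<Rightarrow> nat \<Rightarrow> fm" where
  "tr_tm I \<rho> (Var i) y = at2 (eqF I) (\<rho> i) y"
| "tr_tm I \<rho> (Fun f []) y = at1 (zeroF I) y"
| "tr_tm I \<rho> (Fun f [t]) y =
     Ex (Conj (at1 (domF I) 0) (Conj (tr_tm I (\<lambda>i. Suc (\<rho> i)) t 0) (at2 (sucF I) 0 (Suc y))))"
| "tr_tm I \<rho> (Fun f (t # u # us)) y = Bot"

fun tr :: "translation \<Rightarrow> fm \<Rightarrow> fm" where
  "tr I (Eq s (Var y)) = tr_tm I (\<lambda>i. i) s y"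
| "tr I (Eq s (Fun f ts)) =
     Ex (Conj (at1 (domF I) 0) (Conj (tr_tm I Suc s 0) (tr_tm I Suc (Fun f ts) 0)))"
| "tr I (Rel r ts) = Bot"
| "tr I Bot = Bot"
| "tr I (Imp p q) = Imp (tr I p) (tr I q)"
| "tr I (All p) = All (Imp (at1 (domF I) 0) (tr I p))"

definition interprets_Num :: "translation \<Rightarrow> thy \<Rightarrow> bool" where
  "interprets_Num I T \<longleftrightarrow>
     fm_in (lang_of T) (domF I) \<and> fv (domF I) \<subseteq> {0} \<and>
     fm_in (lang_of T) (eqF I) \<and> fv (eqF I) \<subseteq> {0, 1} \<and>
     fm_in (lang_of T) (zeroF I) \<and> fv (zeroF I) \<subseteq> {0} \<and>
     fm_in (lang_of T) (sucF I) \<and> fv (sucF I) \<subseteq> {0, 1} \<and>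
     T \<turnstile> Ex (Conj (at1 (domF I) 0) (at1 (zeroF I) 0)) \<and>
     T \<turnstile> All (Imp (at1 (domF I) 0) (Ex (Conj (at1 (domF I) 0) (at2 (sucF I) 1 0)))) \<and>
     (\<forall>p. sentence_in (lang_of Num) p \<and> Num \<turnstile> p \<longrightarrow> T \<turnstile> tr I p) \<and>
     (\<forall>p \<in> eq_axioms. T \<turnstile> tr I p)"

definition identity_translation :: translation where
  "identity_translation =
     \<lparr>domF = Eq (Var 0) (Var 0), eqF = Eq (Var 0) (Var 1),
      zeroF = Eq Zero (Var 0), sucF = Eq (Succ (Var 0)) (Var 1)\<rparr>"

definition relational_extension_of_Num :: "thy \<Rightarrow> bool" where
  "relational_extension_of_Num T \<longleftrightarrow>
     funs (lang_of T) = funs (lang_of Num) \<and> (\<forall>p \<in> axioms Num. T \<turnstile> p)"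

definition admissible :: "translation \<Rightarrow> thy \<Rightarrow> bool" where
  "admissible I T \<longleftrightarrow>
     interprets_Num I T \<and> (relational_extension_of_Num T \<longrightarrow> I = identity_translation)"


section \<open>Separation and Rosser theories\<close>

text \<open>
  The variables \<open>x\<^sub>1, \<dots>, x\<^sub>n\<close> of a formula with exactly \<open>n\<close> free variables are
  the indices \<open>0, \<dots>, n - 1\<close>.
\<close>

definition nvar_formula :: "thy \<Rightarrow> nat \<Rightarrow> fm \<Rightarrow> bool" where
  "nvar_formula T n p \<longleftrightarrow> fm_in (lang_of T) p \<and> fv p = {..<n}"

text \<open>
  Under a translation a numeral becomes a formula rather than a term, so that \<open>p\<close>
  applied to the translations of the numerals \<open>a\<^sub>1, \<dots>, a\<^sub>n\<close> is the sentence
  \<open>\<exists>y\<^sub>1 \<dots> y\<^sub>n. (\<And>i. \<delta>(y\<^sub>i) \<and> (a\<^sub>i = y\<^sub>i)\<^sup>I) \<and> p(y\<^sub>1, \<dots>, y\<^sub>n)\<close>.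
  Its negation is the negation of this whole sentence.
\<close>

definition at_numerals :: "translation \<Rightarrow> fm \<Rightarrow> nat list \<Rightarrow> fm" where
  "at_numerals I p as =
     (Ex ^^ length as)
       (foldr Conj
         (map (\<lambda>i. Conj (at1 (domF I) i) (tr_tm I (\<lambda>j. j) (numeral_tm (as ! i)) i))
           [0..<length as])
         p)"

definition strongly_separates ::
  "thy \<Rightarrow> translation \<Rightarrow> nat \<Rightarrow> fm \<Rightarrow> nat list set \<Rightarrow> nat list set \<Rightarrow> bool" where
  "strongly_separates T I n p M1 M2 \<longleftrightarrow>
     nvar_formula T n p \<and>
     (\<forall>as. length as = n \<longrightarrow>
        (as \<in> M1 \<longrightarrow> T \<turnstile> at_numerals I p as) \<and>
        (as \<in> M2 \<longrightarrow> T \<turnstile> Neg (at_numerals I p as)))"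

definition exactly_separates ::
  "thy \<Rightarrow> translation \<Rightarrow> nat \<Rightarrow> fm \<Rightarrow> nat list set \<Rightarrow> nat list set \<Rightarrow> bool" where
  "exactly_separates T I n p M1 M2 \<longleftrightarrow>
     nvar_formula T n p \<and>
     (\<forall>as. length as = n \<longrightarrow>
        (as \<in> M1 \<longleftrightarrow> T \<turnstile> at_numerals I p as) \<and>
        (as \<in> M2 \<longleftrightarrow> T \<turnstile> Neg (at_numerals I p as)))"

definition effectively_Rosser :: "(nat \<Rightarrow> nat list set) \<Rightarrow> nat \<Rightarrow> thy \<Rightarrow> bool" where
  "effectively_Rosser R n T \<longleftrightarrow>
     (\<exists>I f. admissible I T \<and> recursive 2 f \<and>
        (\<forall>i j. \<exists>p. f [i, j] = fm_code p \<and> strongly_separates T I n p (R i - R j) (R j - R i)))"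

definition effectively_exact_Rosser :: "(nat \<Rightarrow> nat list set) \<Rightarrow> nat \<Rightarrow> thy \<Rightarrow> bool" where
  "effectively_exact_Rosser R n T \<longleftrightarrow>
     (\<exists>I f. admissible I T \<and> recursive 2 f \<and>
        (\<forall>i j. R i \<inter> R j = {} \<longrightarrow>
           (\<exists>p. f [i, j] = fm_code p \<and> exactly_separates T I n p (R i) (R j))))"

end

theory Submission
  imports Defs
begin

text \<open>
  Given an effective Rosser function \<open>f\<close> and indices \<open>i\<close>, \<open>j\<close> of disjoint relations, the double
  recursion theorem yields indices \<open>u\<close>, \<open>v\<close>, recursive in \<open>i\<close>, \<open>j\<close>, such that for the formula
  \<open>p\<close> coded by \<open>f(u,v)\<close>

    \<open>R\<^sub>u = R\<^sub>i \<union> {a. T \<turnstile> \<not>p(a)}\<close>  and  \<open>R\<^sub>v = R\<^sub>j \<union> {a. T \<turnstile> p(a)}\<close>.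

  If \<open>a \<in> R\<^sub>i\<close> but \<open>p(a)\<close> is not provable, then \<open>a \<in> R\<^sub>u - R\<^sub>v\<close>, so strong separation makes
  \<open>p(a)\<close> provable after all.  If \<open>p(a)\<close> is provable but \<open>a \<notin> R\<^sub>i\<close>, then by consistency
  \<open>a \<in> R\<^sub>v - R\<^sub>u\<close>, so \<open>\<not>p(a)\<close> is provable too, against consistency.  The argument for \<open>R\<^sub>j\<close> is
  symmetric, so \<open>p\<close> separates \<open>R\<^sub>i\<close> from \<open>R\<^sub>j\<close> exactly.

  The recursion theorem needs provability of \<open>p(a)\<close> to be RE in the code of \<open>p\<close> and in \<open>a\<close>.  Syntax
  and calculus are inductively defined, and an inductive closure under an RE step relation is RE:
  membership is witnessed by a finite list, each entry of which follows by one step from others.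
\<close>

section \<open>Recursive functions\<close>

lemma recursive_comp1:
  assumes "recursive 1 g" "recursive k f"
  shows "recursive k (\<lambda>xs. g [f xs])"
  using recursive.comp[of "[f]" g k] assms by simp

lemma recursive_comp2:
  assumes "recursive 2 g" "recursive k f1" "recursive k f2"
  shows "recursive k (\<lambda>xs. g [f1 xs, f2 xs])"
  using recursive.comp[of "[f1, f2]" g k] assms by (auto simp: numeral_2_eq_2)

text \<open>Unary functions act on numbers rather than on lists; further arguments are packed into
  one number by \<open>prod_encode\<close>, so that composition involves no arities.\<close>

definition rec1 :: "(nat \<Rightarrow> nat) \<Rightarrow> bool" where
  "rec1 f \<longleftrightarrow> recursive 1 (\<lambda>xs. f (xs ! 0))"

lemma recursive_rec1:
  assumes "rec1 f" "recursive k g"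
  shows "recursive k (\<lambda>xs. f (g xs))"
  using recursive_comp1[OF assms(1)[unfolded rec1_def] assms(2)] by simp

lemma rec1_comp: "rec1 f \<Longrightarrow> rec1 g \<Longrightarrow> rec1 (\<lambda>x. f (g x))"
  unfolding rec1_def[of g] rec1_def[of "\<lambda>x. f (g x)"] by (rule recursive_rec1)

lemma rec1_id: "rec1 (\<lambda>x. x)"
  unfolding rec1_def by (intro recursive.proj) simp

lemma rec1_Suc: "rec1 f \<Longrightarrow> rec1 (\<lambda>x. Suc (f x))"
  using rec1_comp[of Suc f] recursive.succ by (simp add: rec1_def)

lemma rec1_const: "rec1 (\<lambda>x. c)"
  by (induction c) (simp_all add: rec1_Suc, simp add: rec1_def recursive.zero)

lemma recursive_prim_rec2:
  assumes "recursive 1 g" "recursive 3 h"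
  shows "recursive 2 (\<lambda>xs. rec_nat (g [xs ! 1]) (\<lambda>y r. h [y, r, xs ! 1]) (xs ! 0))"
proof -
  have "recursive 2 (\<lambda>xs. rec_nat (g (tl xs)) (\<lambda>y r. h (y # r # tl xs)) (hd xs))"
    using recursive.prim_rec[of 1 g h] assms by (simp add: numeral_2_eq_2 numeral_3_eq_3)
  then show ?thesis
    by (rule recursive.ext) (auto simp: numeral_2_eq_2 length_Suc_conv)
qed

definition rec2 :: "(nat \<Rightarrow> nat \<Rightarrow> nat) \<Rightarrow> bool" where
  "rec2 f \<longleftrightarrow> recursive 2 (\<lambda>xs. f (xs ! 0) (xs ! 1))"

lemma recursive_rec2:
  assumes "rec2 f" "recursive k g" "recursive k h"
  shows "recursive k (\<lambda>xs. f (g xs) (h xs))"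
  using recursive_comp2[OF assms(1)[unfolded rec2_def] assms(2,3)] by simp

lemma rec1_rec2: "rec2 f \<Longrightarrow> rec1 g \<Longrightarrow> rec1 h \<Longrightarrow> rec1 (\<lambda>x. f (g x) (h x))"
  unfolding rec1_def by (rule recursive_rec2)

lemma recursive_proj: "i < k \<Longrightarrow> recursive k (\<lambda>xs. xs ! i)"
  by (rule recursive.proj)

lemma recursive_const: "recursive k (\<lambda>xs. c)"
  using recursive_rec1[OF rec1_const recursive.zero] .

lemma rec2_swap: "rec2 f \<Longrightarrow> rec2 (\<lambda>x y. f y x)"
  unfolding rec2_def[of "\<lambda>x y. f y x"] by (rule recursive_rec2[OF _ recursive_proj recursive_proj]) auto

section \<open>Arithmetic up to truncated subtraction and triangular numbers\<close>

lemma rec2_add: "rec2 (+)"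
proof -
  have "recursive 2 (\<lambda>xs. rec_nat ((\<lambda>ys. ys ! 0) [xs ! 1])
      (\<lambda>y r. (\<lambda>ys. Suc (ys ! 1)) [y, r, xs ! 1]) (xs ! 0))"
    by (intro recursive_prim_rec2 recursive_proj recursive_rec1[OF rec1_Suc[OF rec1_id]]) auto
  moreover have "rec_nat b (\<lambda>y r. Suc r) a = a + b" for a b
    by (induction a) auto
  ultimately show ?thesis by (simp add: rec2_def)
qed

lemma rec2_mult: "rec2 (*)"
proof -
  have "recursive 2 (\<lambda>xs. rec_nat ((\<lambda>ys. 0) [xs ! 1])
      (\<lambda>y r. (\<lambda>ys. ys ! 2 + ys ! 1) [y, r, xs ! 1]) (xs ! 0))"
    by (intro recursive_prim_rec2 recursive_proj recursive_const recursive_rec2[OF rec2_add]) auto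
  moreover have "rec_nat 0 (\<lambda>y r. b + r) a = a * b" for a b :: nat
    by (induction a) auto
  ultimately show ?thesis by (simp add: rec2_def)
qed

text \<open>The recursion returns its counter instead of the previous value. The second argument is
  a dummy, removed at the end by making both arguments equal.\<close>

lemma rec1_pred: "rec1 (\<lambda>x. x - 1)"
proof -
  have "recursive 2 (\<lambda>xs. rec_nat ((\<lambda>ys. 0) [xs ! 1])
      (\<lambda>y r. (\<lambda>ys. ys ! 0) [y, r, xs ! 1]) (xs ! 0))"
    by (intro recursive_prim_rec2 recursive_proj recursive_const) auto
  moreover have "rec_nat 0 (\<lambda>y r. y) a = a - 1" for a :: nat
    by (cases a) auto
  ultimately have "rec2 (\<lambda>a b. a - 1)" by (simp add: rec2_def)
  then show ?thesis by (rule rec1_rec2) (rule rec1_id)+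
qed

text \<open>Subtraction iterates the predecessor by recursion on the subtrahend; this yields the
  arguments in reverse order, hence the final swap.\<close>

lemma rec2_diff: "rec2 (-)"
proof -
  have "recursive 2 (\<lambda>xs. rec_nat ((\<lambda>ys. ys ! 0) [xs ! 1])
      (\<lambda>y r. (\<lambda>ys. ys ! 1 - 1) [y, r, xs ! 1]) (xs ! 0))"
    by (intro recursive_prim_rec2 recursive_proj recursive_rec1[OF rec1_pred]) auto
  moreover have "rec_nat b (\<lambda>y r. r - 1) a = b - a" for a b :: nat
    by (induction a) auto
  ultimately have "rec2 (\<lambda>a b. b - a)" by (simp add: rec2_def)
  then show ?thesis by (rule rec2_swap)
qed

lemma rec1_triangle: "rec1 triangle"
proof -
  have "recursive 2 (\<lambda>xs. rec_nat ((\<lambda>ys. 0) [xs ! 1])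
      (\<lambda>y r. (\<lambda>ys. ys ! 1 + Suc (ys ! 0)) [y, r, xs ! 1]) (xs ! 0))"
    by (intro recursive_prim_rec2 recursive_proj recursive_const
        recursive_rec2[OF rec2_add] recursive_rec1[OF rec1_Suc[OF rec1_id]]) auto
  moreover have "rec_nat 0 (\<lambda>y r. r + Suc y) a = triangle a" for a :: nat
    by (induction a) auto
  ultimately have "rec2 (\<lambda>a b. triangle a)" by (simp add: rec2_def)
  then show ?thesis by (rule rec1_rec2) (rule rec1_id)+
qed

section \<open>The pairing function and its inverses\<close>

lemma rec2_prod_encode: "rec2 (\<lambda>a b. prod_encode (a, b))"
  unfolding rec2_def prod_encode_def prod.case
  by (intro recursive_rec2[OF rec2_add] recursive_rec1[OF rec1_triangle] recursive_proj) auto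

abbreviation pfst :: "nat \<Rightarrow> nat" where "pfst z \<equiv> fst (prod_decode z)"
abbreviation psnd :: "nat \<Rightarrow> nat" where "psnd z \<equiv> snd (prod_decode z)"

lemma triangle_mono: "m \<le> n \<Longrightarrow> triangle m \<le> triangle n"
  by (induction n) (auto simp: le_Suc_eq)

text \<open>Since \<open>prod_encode (a, b) = triangle (a + b) + a\<close>, the code is at least
  \<open>triangle (a + b)\<close> and strictly below \<open>triangle (Suc (a + b))\<close>. The
  outer \<open>Suc\<close> turns the strict inequality into the vanishing of a truncated
  difference.\<close>

lemma Least_triangle_prod_encode:
  "(LEAST w. Suc (prod_encode (a, b)) - triangle (Suc w) = 0) = a + b"
proof (rule Least_equality)
  show "Suc (prod_encode (a, b)) - triangle (Suc (a + b)) = 0"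
    by (simp add: prod_encode_def)
  fix w assume w: "Suc (prod_encode (a, b)) - triangle (Suc w) = 0"
  show "a + b \<le> w"
  proof (rule ccontr)
    assume "\<not> a + b \<le> w"
    then have "triangle (Suc w) \<le> triangle (a + b)" by (intro triangle_mono) simp
    with w show False by (simp add: prod_encode_def)
  qed
qed

lemma rec1_pfst_add_psnd: "rec1 (\<lambda>z. pfst z + psnd z)"
proof -
  have "recursive 1 (\<lambda>xs. LEAST w. (\<lambda>ys. Suc (ys ! 1) - triangle (Suc (ys ! 0))) (w # xs) = 0)"
  proof (rule recursive.minim)
    show "recursive (Suc 1) (\<lambda>ys. Suc (ys ! 1) - triangle (Suc (ys ! 0)))"
      by (intro recursive_rec2[OF rec2_diff] recursive_rec1[OF rec1_triangle]
        recursive_rec1[OF rec1_Suc[OF rec1_id]] recursive_proj) auto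
    fix xs :: "nat list"
    show "\<exists>y. Suc ((y # xs) ! 1) - triangle (Suc ((y # xs) ! 0)) = 0"
      \<comment> \<open>The input \<open>z\<close> itself ends the search, as
        \<open>triangle (Suc z)\<close> is at least \<open>Suc z\<close>.\<close>
      by (rule exI[of _ "xs ! 0"]) simp
  qed
  moreover have "(LEAST w. Suc z - triangle (Suc w) = 0) = pfst z + psnd z" for z
    using Least_triangle_prod_encode[of "pfst z" "psnd z"] by simp
  ultimately show ?thesis by (simp add: rec1_def del: triangle_Suc)
qed

lemma rec1_pfst: "rec1 pfst"
proof -
  have "rec1 (\<lambda>z. z - triangle (pfst z + psnd z))"
    by (intro rec1_rec2[OF rec2_diff] rec1_id rec1_comp[OF rec1_triangle] rec1_pfst_add_psnd)
  moreover have "z - triangle (pfst z + psnd z) = pfst z" for z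
    using prod_decode_inverse[of z] by (simp add: prod_encode_def split_beta)
  ultimately show ?thesis by simp
qed

lemma rec1_psnd: "rec1 psnd"
  using rec1_rec2[OF rec2_diff rec1_pfst_add_psnd rec1_pfst] by simp

lemma rec1_prod_encode: "rec1 f \<Longrightarrow> rec1 g \<Longrightarrow> rec1 (\<lambda>x. prod_encode (f x, g x))"
  by (rule rec1_rec2[OF rec2_prod_encode])

text \<open>Primitive recursion for unary functions: counter, previous value and parameter are
  packed into one number, and the number of rounds \<open>f x\<close> is computed from the same
  argument \<open>x\<close>.\<close>

lemma rec1_rec_nat:
  assumes "rec1 g" "rec1 h" "rec1 f"
  shows "rec1 (\<lambda>x. rec_nat (g x) (\<lambda>y r. h (prod_encode (y, prod_encode (r, x)))) (f x))"
proof -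
  have "recursive 2 (\<lambda>xs. rec_nat ((\<lambda>ys. g (ys ! 0)) [xs ! 1])
      (\<lambda>y r. (\<lambda>ys. h (prod_encode (ys ! 0, prod_encode (ys ! 1, ys ! 2)))) [y, r, xs ! 1]) (xs ! 0))"
    by (intro recursive_prim_rec2 recursive_rec1[OF assms(1)] recursive_rec1[OF assms(2)]
        recursive_rec2[OF rec2_prod_encode] recursive_proj) auto
  then have "rec2 (\<lambda>n x. rec_nat (g x) (\<lambda>y r. h (prod_encode (y, prod_encode (r, x)))) n)"
    by (simp add: rec2_def)
  from rec1_rec2[OF this assms(3) rec1_id] show ?thesis .
qed

lemmas rec1_intros = rec1_id rec1_const rec1_Suc rec1_prod_encode
  rec1_comp[OF rec1_pfst] rec1_comp[OF rec1_psnd]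
  rec1_rec2[OF rec2_add] rec1_rec2[OF rec2_mult] rec1_rec2[OF rec2_diff]


section \<open>Recursively enumerable sets of numbers\<close>

text \<open>The unary form of recursive enumerability; the search variable is the first component of
  the pair.\<close>

definition re :: "(nat \<Rightarrow> bool) \<Rightarrow> bool" where
  "re Q \<longleftrightarrow> (\<exists>F. rec1 F \<and> (\<forall>c. Q c \<longleftrightarrow> (\<exists>y. F (prod_encode (y, c)) = 0)))"

lemma reI: "rec1 F \<Longrightarrow> (\<And>c. Q c \<longleftrightarrow> (\<exists>y. F (prod_encode (y, c)) = 0)) \<Longrightarrow> re Q"
  by (auto simp: re_def)

section \<open>Closure properties of recursively enumerable predicates\<close>

lemma re_eq_0: "rec1 f \<Longrightarrow> re (\<lambda>c. f c = 0)"
  by (rule reI[of "\<lambda>z. f (psnd z)"]) (rule rec1_comp, assumption, rule rec1_psnd, simp)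

lemma re_comp:
  assumes "re Q" "rec1 f"
  shows "re (\<lambda>c. Q (f c))"
proof -
  from assms(1) obtain F where F: "rec1 F" "\<And>c. Q c \<longleftrightarrow> (\<exists>y. F (prod_encode (y, c)) = 0)"
    unfolding re_def by blast
  show ?thesis
    by (rule reI[of "\<lambda>z. F (prod_encode (pfst z, f (psnd z)))"])
      (auto simp: F(2) intro!: rec1_intros rec1_comp[OF F(1)] rec1_comp[OF assms(2)])
qed

text \<open>The witness is a pair with one component for each conjunct, and a sum of naturals
  vanishes exactly when both summands do.\<close>

lemma re_conj:
  assumes "re P" "re Q"
  shows "re (\<lambda>c. P c \<and> Q c)"
proof -
  from assms(1) obtain F where F: "rec1 F" "\<And>c. P c \<longleftrightarrow> (\<exists>y. F (prod_encode (y, c)) = 0)"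
    unfolding re_def by blast
  from assms(2) obtain G where G: "rec1 G" "\<And>c. Q c \<longleftrightarrow> (\<exists>y. G (prod_encode (y, c)) = 0)"
    unfolding re_def by blast
  show ?thesis
  proof (rule reI)
    show "rec1 (\<lambda>z. F (prod_encode (pfst (pfst z), psnd z)) + G (prod_encode (psnd (pfst z), psnd z)))"
      by (intro rec1_intros rec1_comp[OF F(1)] rec1_comp[OF G(1)])
    fix c
    show "P c \<and> Q c \<longleftrightarrow> (\<exists>y. F (prod_encode (pfst (pfst (prod_encode (y, c))), psnd (prod_encode (y, c))))
      + G (prod_encode (psnd (pfst (prod_encode (y, c))), psnd (prod_encode (y, c)))) = 0)"
      unfolding F G by (auto, metis prod_encode_inverse fst_conv snd_conv)
  qed
qed

text \<open>A product vanishes as soon as one factor does, so a witness for either disjunct serves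
  unchanged.\<close>

lemma re_disj:
  assumes "re P" "re Q"
  shows "re (\<lambda>c. P c \<or> Q c)"
proof -
  from assms(1) obtain F where F: "rec1 F" "\<And>c. P c \<longleftrightarrow> (\<exists>y. F (prod_encode (y, c)) = 0)"
    unfolding re_def by blast
  from assms(2) obtain G where G: "rec1 G" "\<And>c. Q c \<longleftrightarrow> (\<exists>y. G (prod_encode (y, c)) = 0)"
    unfolding re_def by blast
  show ?thesis
  proof (rule reI)
    show "rec1 (\<lambda>z. F z * G z)"
      by (intro rec1_rec2[OF rec2_mult] F(1) G(1))
    show "P c \<or> Q c \<longleftrightarrow> (\<exists>y. F (prod_encode (y, c)) * G (prod_encode (y, c)) = 0)" for c
      unfolding F(2) G(2) by auto
  qed
qed

text \<open>The quantified value joins the old witness in a pair, giving a single search.\<close>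

lemma re_ex:
  assumes "re Q"
  shows "re (\<lambda>c. \<exists>x. Q (prod_encode (c, x)))"
proof -
  from assms obtain F where F: "rec1 F" "\<And>c. Q c \<longleftrightarrow> (\<exists>y. F (prod_encode (y, c)) = 0)"
    unfolding re_def by blast
  show ?thesis
  proof (rule reI)
    show "rec1 (\<lambda>z. F (prod_encode (pfst (pfst z), prod_encode (psnd z, psnd (pfst z)))))"
      by (intro rec1_intros rec1_comp[OF F(1)])
    show "(\<exists>x. Q (prod_encode (c, x))) \<longleftrightarrow> (\<exists>y. F (prod_encode (pfst (pfst (prod_encode (y, c))),
      prod_encode (psnd (prod_encode (y, c)), psnd (pfst (prod_encode (y, c)))))) = 0)" for c
      unfolding F by (auto, metis prod_encode_inverse fst_conv snd_conv)
  qed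
qed

lemma rec_nat_sum_eq_0: "rec_nat 0 (\<lambda>i r. r + f i) n = (0::nat) \<longleftrightarrow> (\<forall>i<n. f i = 0)"
  by (induction n) (auto simp: less_Suc_eq)

lemma rec_nat_prod_eq_0: "rec_nat 1 (\<lambda>i r. r * f i) n = (0::nat) \<longleftrightarrow> (\<exists>i<n. f i = 0)"
  by (induction n) (auto simp: less_Suc_eq)

text \<open>Finitely many witnesses have a common bound \<open>N\<close>. The search is for
  \<open>N\<close>, and with \<open>N\<close> given the test is a finite sum of finite
  products.\<close>

lemma re_ball_less:
  assumes "re Q"
  shows "re (\<lambda>c. \<forall>i < psnd c. Q (prod_encode (pfst c, i)))"
proof -
  from assms obtain F where F: "rec1 F" "\<And>c. Q c \<longleftrightarrow> (\<exists>y. F (prod_encode (y, c)) = 0)"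
    unfolding re_def by blast
  \<comment> \<open>This product vanishes exactly when some \<open>w < N\<close> is a witness for
    \<open>i\<close>; the sum \<open>H\<close> below vanishes exactly when every
    \<open>i < n\<close> has such a witness.\<close>
  define G where "G N c i = rec_nat 1 (\<lambda>w r. r * F (prod_encode (w, prod_encode (c, i)))) N"
    for N c i
  have G0: "G N c i = 0 \<longleftrightarrow> (\<exists>w<N. F (prod_encode (w, prod_encode (c, i))) = 0)" for N c i
    unfolding G_def by (rule rec_nat_prod_eq_0)
  have G: "rec1 (\<lambda>v. G (a v) (b v) (i v))" if "rec1 a" "rec1 b" "rec1 i" for a b i
  proof -
    have "rec1 (\<lambda>v. pfst (psnd v) * F (prod_encode (pfst v, psnd (psnd (psnd v)))))"
      by (intro rec1_intros rec1_comp[OF F(1)])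
    from rec1_rec_nat[OF rec1_const[of 1] this rec1_pfst]
    have "rec1 (\<lambda>z. G (pfst z) (pfst (psnd z)) (psnd (psnd z)))"
      by (simp add: G_def)
    from rec1_comp[OF this rec1_prod_encode[OF that(1) rec1_prod_encode[OF that(2,3)]]]
    show ?thesis by simp
  qed
  define H where "H N c n = rec_nat 0 (\<lambda>i r. r + G N c i) n" for N c n
  have H0: "H N c n = 0 \<longleftrightarrow> (\<forall>i<n. \<exists>w<N. F (prod_encode (w, prod_encode (c, i))) = 0)" for N c n
    unfolding H_def rec_nat_sum_eq_0 G0 ..
  have H: "rec1 (\<lambda>z. H (pfst z) (pfst (psnd z)) (psnd (psnd z)))"
  proof -
    have "rec1 (\<lambda>v. pfst (psnd v) +
        G (pfst (psnd (psnd v))) (pfst (psnd (psnd (psnd v)))) (pfst v))"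
      by (intro rec1_rec2[OF rec2_add] G rec1_intros)
    from rec1_rec_nat[OF rec1_const[of 0] this rec1_comp[OF rec1_psnd rec1_psnd]]
    show ?thesis by (simp add: H_def)
  qed
  show ?thesis
  proof (rule reI[OF H])
    fix c
    have "(\<forall>i<n. \<exists>y. F (prod_encode (y, prod_encode (c, i))) = 0) \<longleftrightarrow>
      (\<exists>N. \<forall>i<n. \<exists>w<N. F (prod_encode (w, prod_encode (c, i))) = 0)" for c n
    proof
      assume "\<forall>i<n. \<exists>y. F (prod_encode (y, prod_encode (c, i))) = 0"
      then obtain y where y: "\<And>i. i < n \<Longrightarrow> F (prod_encode (y i, prod_encode (c, i))) = 0"
        by metis
      \<comment> \<open>One more than the sum of all witnesses exceeds each of them.\<close>
      have "y i < Suc (\<Sum>j<n. y j)" if "i < n" for i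
        using member_le_sum[of i "{..<n}" y] that by auto
      with y show "\<exists>N. \<forall>i<n. \<exists>w<N. F (prod_encode (w, prod_encode (c, i))) = 0"
        by blast
    qed blast
    then show "(\<forall>i<psnd c. Q (prod_encode (pfst c, i))) \<longleftrightarrow>
      (\<exists>y. H (pfst (prod_encode (y, c))) (pfst (psnd (prod_encode (y, c))))
        (psnd (psnd (prod_encode (y, c)))) = 0)"
      by (simp add: F(2) H0)
  qed
qed

lemma re_cong: "re P \<Longrightarrow> (\<And>c. P c \<longleftrightarrow> Q c) \<Longrightarrow> re Q"
  by (erule back_subst[of re]) (simp add: fun_eq_iff)

lemma re_eq:
  assumes "rec1 f" "rec1 g"
  shows "re (\<lambda>c. f c = g c)"
proof -
  have "re (\<lambda>c. (f c - g c) + (g c - f c) = 0)"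
    by (intro re_eq_0 rec1_rec2[OF rec2_add] rec1_rec2[OF rec2_diff] assms)
  then show ?thesis by (rule re_cong) auto
qed

text \<open>A nonempty list has the code \<open>Suc (prod_encode (x, c))\<close> with
  \<open>c\<close> the code of its tail, so predecessor and \<open>psnd\<close> remove the head. The
  empty list has code 0, which this step leaves fixed.\<close>

definition code_drop :: "nat \<Rightarrow> nat \<Rightarrow> nat" where
  "code_drop n c = rec_nat c (\<lambda>_ r. psnd (r - 1)) n"

lemma decode_0: "prod_decode 0 = (0, 0)"
  using prod_encode_inverse[of "(0, 0)"] by (simp add: prod_encode_def)

lemma code_drop_list_encode: "code_drop n (list_encode xs) = list_encode (drop n xs)"
proof (induction n)
  case 0
  then show ?case by (simp add: code_drop_def)
next
  case (Suc n)
  have 0: "list_encode (tl ys) = psnd (list_encode ys - 1)" for ys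
    by (cases ys) (simp_all add: decode_0)
  have "drop (Suc n) xs = tl (drop n xs)"
    by (simp add: drop_Suc tl_drop)
  with Suc show ?case by (simp add: code_drop_def 0)
qed

lemma rec1_code_drop: "rec1 f \<Longrightarrow> rec1 g \<Longrightarrow> rec1 (\<lambda>x. code_drop (f x) (g x))"
proof -
  have "rec1 (\<lambda>v. psnd (pfst (psnd v) - 1))"
    by (intro rec1_intros)
  from rec1_rec_nat[OF rec1_psnd this rec1_pfst]
  have 1: "rec1 (\<lambda>z. code_drop (pfst z) (psnd z))"
    by (simp add: code_drop_def)
  assume "rec1 f" "rec1 g"
  from rec1_comp[OF 1 rec1_prod_encode[OF this]] show ?thesis by simp
qed

text \<open>Quantifiers over positions can thus be bounded by the code itself, without computing the
  length.\<close>

lemma length_le_list_encode: "length xs \<le> list_encode xs"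
proof (induction xs)
  case (Cons x xs)
  then show ?case using le_prod_encode_2[of "list_encode xs" x] by simp
qed simp


section \<open>Semidecidable predicates and computable functions on coded types\<close>

text \<open>A recursively enumerable range makes codes recognisable, so that predicates on the type
  can be handled as predicates on numbers. On terms and formulas \<open>enc\<close> will be the
  Goedel numbering.\<close>

class coded =
  fixes enc :: "'a \<Rightarrow> nat"
  assumes enc_inject: "enc x = enc y \<Longrightarrow> x = y"
    and re_range_enc: "re (\<lambda>c. \<exists>x. c = enc x)"

lemma enc_eq_iff: "enc x = enc y \<longleftrightarrow> x = y"
  using enc_inject by blast

section \<open>Numbers, pairs and lists as coded types\<close>

instantiation nat :: coded
begin
definition enc_nat :: "nat \<Rightarrow> nat" where [simp]: "enc_nat n = n"
instance
proof
  show "re (\<lambda>c. \<exists>x. c = enc (x::nat))"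
    by (rule re_cong[OF re_eq_0[OF rec1_const[of 0]]]) simp
qed simp
end

instantiation prod :: (coded, coded) coded
begin
definition enc_prod :: "'a \<times> 'b \<Rightarrow> nat" where
  "enc_prod p = prod_encode (enc (fst p), enc (snd p))"
instance
proof
  fix x y :: "'a \<times> 'b"
  show "enc x = enc y \<Longrightarrow> x = y"
    by (simp add: enc_prod_def enc_eq_iff prod_eq_iff)
next
  have "re (\<lambda>c. (\<exists>x. pfst c = enc (x::'a)) \<and> (\<exists>y. psnd c = enc (y::'b)))"
    by (intro re_conj re_comp[OF re_range_enc] rec1_pfst rec1_psnd)
  then show "re (\<lambda>c. \<exists>x. c = enc (x::'a \<times> 'b))"
    by (rule re_cong) (auto simp: enc_prod_def, metis prod.collapse prod_decode_inverse)
qed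
end

instantiation list :: (coded) coded
begin
definition enc_list :: "'a list \<Rightarrow> nat" where
  "enc_list xs = list_encode (map enc xs)"
instance
proof
  fix xs ys :: "'a list"
  assume "enc xs = enc ys"
  then have "map enc xs = map enc ys" by (simp add: enc_list_def list_encode_eq)
  moreover have "inj (enc :: 'a \<Rightarrow> nat)" by (auto intro: injI enc_inject)
  ultimately show "xs = ys" by (metis inj_map_eq_map)
next
  \<comment> \<open>Position \<open>i\<close> is either past the end, where the remaining code is 0,
    or holds the code of an element. As the length is at most \<open>c\<close>, checking all
    \<open>i < c\<close> covers the whole list.\<close>
  let ?C = "\<lambda>c i. code_drop i c = 0 \<or> (\<exists>x. pfst (code_drop i c - 1) = enc (x::'a))"
  have "re (\<lambda>z. code_drop (psnd z) (pfst z) = 0 \<or>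
      (\<exists>x. pfst (code_drop (psnd z) (pfst z) - 1) = enc (x::'a)))"
    by (intro re_disj re_eq_0 re_comp[OF re_range_enc] rec1_intros rec1_code_drop)
  from re_comp[OF re_ball_less[OF this] rec1_prod_encode[OF rec1_id rec1_id]]
  have "re (\<lambda>c. \<forall>i<c. ?C c i)" by simp
  then show "re (\<lambda>c. \<exists>xs. c = enc (xs::'a list))"
  proof (rule re_cong)
    fix c
    show "(\<forall>i<c. ?C c i) \<longleftrightarrow> (\<exists>xs. c = enc (xs::'a list))"
    proof
      assume c: "\<forall>i<c. ?C c i"
      define L where "L = list_decode c"
      have L: "c = list_encode L" by (simp add: L_def)
      have "\<exists>x. L ! i = enc (x::'a)" if "i < length L" for i
      proof -
        from that have "i < c" using length_le_list_encode[of L] L by simp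
        with c have "?C c i" by blast
        moreover have "drop i L = L ! i # drop (Suc i) L"
          using that by (simp add: Cons_nth_drop_Suc)
        ultimately show ?thesis by (simp add: L code_drop_list_encode)
      qed
      then obtain f where "\<And>i. i < length L \<Longrightarrow> L ! i = enc (f i :: 'a)" by metis
      then have "L = map enc (map f [0..<length L])" by (intro nth_equalityI) auto
      then have "c = enc (map f [0..<length L])" using L unfolding enc_list_def by simp
      then show "\<exists>xs. c = enc (xs::'a list)" by blast
    next
      assume "\<exists>xs. c = enc (xs::'a list)"
      then obtain xs :: "'a list" where c: "c = list_encode (map enc xs)"
        by (auto simp: enc_list_def)
      show "\<forall>i<c. ?C c i"
      proof (intro allI impI)
        fix i
        show "?C c i"
          by (cases "drop i xs") (auto simp: c code_drop_list_encode drop_map)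
      qed
    qed
  qed
qed
end

lemma enc_Pair [simp]: "enc (x, y) = prod_encode (enc x, enc y)"
  by (simp add: enc_prod_def)

lemma enc_Nil [simp]: "enc [] = 0"
  by (simp add: enc_list_def)

lemma enc_Cons [simp]: "enc (x # xs) = Suc (prod_encode (enc x, enc xs))"
  by (simp add: enc_list_def)

lemma enc_nat_list: "enc (xs :: nat list) = list_encode xs"
proof -
  have "map enc xs = xs" by (induction xs) simp_all
  then show ?thesis by (simp add: enc_list_def)
qed

lemma length_le_enc: "length xs \<le> enc xs"
  using length_le_list_encode[of "map enc xs"] by (simp add: enc_list_def)

definition semidec :: "('a::coded \<Rightarrow> bool) \<Rightarrow> bool" where
  "semidec P \<longleftrightarrow> re (\<lambda>c. \<exists>x. c = enc x \<and> P x)"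

lemma re_iff_semidec: "re P \<longleftrightarrow> semidec P"
  by (simp add: semidec_def)

text \<open>
  Computability is defined through the graph, so that no recursive function has to be totalised
  on numbers that are not codes.
\<close>

definition computable :: "('a::coded \<Rightarrow> 'b::coded) \<Rightarrow> bool" where
  "computable f \<longleftrightarrow> semidec (\<lambda>p. snd p = f (fst p))"

section \<open>Closure properties of semidecidable predicates and computable functions\<close>

lemma semidec_cong: "semidec P \<Longrightarrow> (\<And>x. P x \<longleftrightarrow> Q x) \<Longrightarrow> semidec Q"
  by (erule back_subst[of semidec]) (simp add: fun_eq_iff)

lemma semidec_conj: "semidec P \<Longrightarrow> semidec Q \<Longrightarrow> semidec (\<lambda>x. P x \<and> Q x)"
  unfolding semidec_def by (drule (1) re_conj, erule re_cong) (auto simp: enc_eq_iff)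

lemma semidec_disj: "semidec P \<Longrightarrow> semidec Q \<Longrightarrow> semidec (\<lambda>x. P x \<or> Q x)"
  unfolding semidec_def by (drule (1) re_disj, erule re_cong) auto

lemma semidec_ex:
  assumes "semidec (\<lambda>p. P (fst p) (snd p))"
  shows "semidec (\<lambda>x. \<exists>y. P x y)"
proof -
  have "re (\<lambda>c. \<exists>d. \<exists>p. prod_encode (c, d) = enc p \<and> P (fst p) (snd p))"
    using assms unfolding semidec_def by (rule re_ex)
  then show ?thesis
    unfolding semidec_def
  proof (rule re_cong)
    show "(\<exists>d p. prod_encode (c, d) = enc p \<and> P (fst p) (snd p)) \<longleftrightarrow>
        (\<exists>x. c = enc x \<and> (\<exists>y. P x y))" for c
      by (auto simp: enc_prod_def)
  qed
qed

text \<open>The graph of \<open>f\<close> is the graph of \<open>F\<close> cut down to arguments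
  that are codes.\<close>

lemma computable_code:
  fixes f :: "'a::coded \<Rightarrow> 'b::coded"
  assumes "rec1 F" "\<And>x. enc (f x) = F (enc x)"
  shows "computable f"
proof -
  have "re (\<lambda>z. (\<exists>x. pfst z = enc (x::'a)) \<and> psnd z = F (pfst z))"
    by (intro re_conj re_comp[OF re_range_enc] re_eq rec1_comp[OF assms(1)] rec1_pfst rec1_psnd)
  then show ?thesis
    unfolding computable_def semidec_def
  proof (rule re_cong)
    fix z
    show "(\<exists>x. pfst z = enc (x::'a)) \<and> psnd z = F (pfst z) \<longleftrightarrow>
        (\<exists>p. z = enc p \<and> snd p = f (fst p))"
      by (auto simp: assms(2) enc_prod_def intro!: exI[of _ "(_, f _)"])
        (metis prod.collapse prod_decode_inverse)
  qed
qed

lemma computable_id: "computable (\<lambda>x. x)"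
  by (rule computable_code[OF rec1_id]) simp

lemma computable_const: "computable (\<lambda>x. a)"
  by (rule computable_code[OF rec1_const[of "enc a"]]) simp

text \<open>The value \<open>f x\<close> is searched for and verified against the graph of
  \<open>f\<close>.\<close>

lemma semidec_compose:
  assumes "semidec P" "computable f"
  shows "semidec (\<lambda>x. P (f x))"
proof -
  have "re (\<lambda>z. (\<exists>p. z = enc p \<and> snd p = f (fst p)) \<and> (\<exists>y. psnd z = enc y \<and> P y))"
    using assms unfolding semidec_def computable_def
    by (intro re_conj re_comp[OF _ rec1_psnd])
  from re_ex[OF this] show ?thesis
    unfolding semidec_def by (rule re_cong) (auto simp: enc_eq_iff enc_prod_def)
qed

lemma computable_compose1:
  assumes "computable f" "computable (g :: 'a::coded \<Rightarrow> 'b::coded)"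
  shows "computable (\<lambda>x. f (g x))"
proof -
  \<comment> \<open>Such regroupings are checked on codes here, since the rules for projections rest
    on this lemma.\<close>
  have perm1: "computable (\<lambda>p::('a \<times> 'c::coded) \<times> 'b. (fst (fst p), snd p))"
    by (rule computable_code[of "\<lambda>z. prod_encode (pfst (pfst z), psnd z)"])
      (intro rec1_intros, simp add: enc_prod_def)
  have perm2: "computable (\<lambda>p::('a \<times> 'c::coded) \<times> 'b. (snd p, snd (fst p)))"
    by (rule computable_code[of "\<lambda>z. prod_encode (psnd z, psnd (pfst z))"])
      (intro rec1_intros, simp add: enc_prod_def)
  have "semidec (\<lambda>p. snd p = g (fst (fst p)) \<and> snd (fst p) = f (snd p))"
    using semidec_conj[OF semidec_compose[OF assms(2)[unfolded computable_def] perm1]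
        semidec_compose[OF assms(1)[unfolded computable_def] perm2]] by simp
  then have "semidec (\<lambda>p. \<exists>y. y = g (fst p) \<and> snd p = f y)"
    by (rule semidec_ex)
  then show ?thesis by (simp add: computable_def)
qed

lemma computable_fst: "computable f \<Longrightarrow> computable (\<lambda>x. fst (f x))"
  by (rule computable_compose1[of fst], rule computable_code[OF rec1_pfst]) (simp_all add: enc_prod_def)

lemma computable_snd: "computable f \<Longrightarrow> computable (\<lambda>x. snd (f x))"
  by (rule computable_compose1[of snd], rule computable_code[OF rec1_psnd]) (simp_all add: enc_prod_def)

lemma computable_Pair:
  assumes "computable (f :: 'a::coded \<Rightarrow> 'b::coded)" "computable (g :: 'a \<Rightarrow> 'c::coded)"
  shows "computable (\<lambda>x. (f x, g x))"
proof -
  have perm1: "computable (\<lambda>p::'a \<times> 'b \<times> 'c. (fst p, fst (snd p)))"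
    by (rule computable_code[of "\<lambda>z. prod_encode (pfst z, pfst (psnd z))"])
      (intro rec1_intros, simp add: enc_prod_def)
  have perm2: "computable (\<lambda>p::'a \<times> 'b \<times> 'c. (fst p, snd (snd p)))"
    by (rule computable_code[of "\<lambda>z. prod_encode (pfst z, psnd (psnd z))"])
      (intro rec1_intros, simp add: enc_prod_def)
  have "semidec (\<lambda>p. fst (snd p) = f (fst p) \<and> snd (snd p) = g (fst p))"
    using semidec_conj[OF semidec_compose[OF assms(1)[unfolded computable_def] perm1]
        semidec_compose[OF assms(2)[unfolded computable_def] perm2]] by simp
  then show ?thesis
    unfolding computable_def by (rule semidec_cong) (auto simp: prod_eq_iff)
qed

lemma computable_compose2:
  assumes "computable (\<lambda>p. f (fst p) (snd p))" "computable g" "computable h"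
  shows "computable (\<lambda>x. f (g x) (h x))"
  using computable_compose1[OF assms(1) computable_Pair[OF assms(2,3)]] by simp

lemma semidec_compose2:
  assumes "semidec (\<lambda>p. P (fst p) (snd p))" "computable g" "computable h"
  shows "semidec (\<lambda>x. P (g x) (h x))"
  using semidec_compose[OF assms(1) computable_Pair[OF assms(2,3)]] by simp

lemma semidec_eq:
  assumes "computable f" "computable g"
  shows "semidec (\<lambda>x. f x = g x)"
proof -
  have "semidec (\<lambda>x. \<exists>y. y = f x \<and> y = g x)"
    by (intro semidec_ex semidec_conj) (use assms in \<open>simp_all add: computable_def\<close>)
  then show ?thesis by (rule semidec_cong) auto
qed

text \<open>The bound is found by an existential search and verified against the graph of
  \<open>f\<close>, which reduces the claim to a numerical bound.\<close>

lemma semidec_ball_less: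
  fixes f :: "'a::coded \<Rightarrow> nat"
  assumes "semidec (\<lambda>p. P (fst p) (snd p))" "computable f"
  shows "semidec (\<lambda>x. \<forall>i<f x. P x i)"
proof -
  let ?Q = "\<lambda>c. \<exists>p. c = enc p \<and> P (fst p) (snd p)"
  have Q: "re (\<lambda>c. \<forall>i < psnd c. ?Q (prod_encode (pfst c, i)))"
    using re_ball_less assms(1) unfolding semidec_def by blast
  have G: "re (\<lambda>c. \<exists>p. c = enc p \<and> snd p = f (fst p))"
    using assms(2) unfolding semidec_def computable_def .
  show ?thesis
    unfolding semidec_def
  proof (rule re_cong[OF re_ex[OF re_conj[OF Q G]]])
    show "(\<exists>n. (\<forall>i<psnd (prod_encode (c, n)). ?Q (prod_encode (pfst (prod_encode (c, n)), i))) \<and>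
        (\<exists>p. prod_encode (c, n) = enc p \<and> snd p = f (fst p))) \<longleftrightarrow>
      (\<exists>x. c = enc x \<and> (\<forall>i<f x. P x i))" for c
      by (auto simp: enc_prod_def enc_eq_iff)
  qed
qed

section \<open>Computable arithmetic and list operations\<close>

lemma computable_Suc: "computable f \<Longrightarrow> computable (\<lambda>x. Suc (f x))"
  by (rule computable_compose1[of Suc], rule computable_code[OF rec1_Suc[OF rec1_id]]) simp_all

lemma computable_add: "computable f \<Longrightarrow> computable g \<Longrightarrow> computable (\<lambda>x. f x + g x :: nat)"
  by (rule computable_compose2[of "(+)"], rule computable_code[OF rec1_pfst_add_psnd])
    (simp_all add: enc_prod_def)

lemma computable_prod_encode:
  "computable f \<Longrightarrow> computable g \<Longrightarrow> computable (\<lambda>x. prod_encode (f x, g x))"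
  by (rule computable_compose2[of "\<lambda>a b. prod_encode (a, b)"], rule computable_code[OF rec1_id])
    (simp_all add: enc_prod_def)

lemma computable_enc: "computable f \<Longrightarrow> computable (\<lambda>x. enc (f x))"
  by (rule computable_compose1[of enc], rule computable_code[OF rec1_id]) simp_all

text \<open>By injectivity of \<open>enc\<close> the graph can be tested on codes. This handles
  constructors, whose codes are arithmetical expressions in the codes of their arguments.\<close>

lemma computable_via_enc:
  fixes f :: "'a::coded \<Rightarrow> 'b::coded"
  assumes "computable (\<lambda>x. enc (f x))"
  shows "computable f"
proof -
  have "semidec (\<lambda>p :: 'a \<times> 'b. enc (snd p) = enc (f (fst p)))"
    by (intro semidec_eq computable_compose1[OF assms] computable_enc computable_snd
        computable_fst computable_id)
  then show ?thesis unfolding computable_def by (simp add: enc_eq_iff)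
qed

lemma computable_Cons: "computable f \<Longrightarrow> computable g \<Longrightarrow> computable (\<lambda>x. f x # g x)"
  by (rule computable_via_enc) (simp add: computable_Suc computable_prod_encode computable_enc)

lemma computable_drop:
  assumes "computable f" "computable (g :: 'a::coded \<Rightarrow> 'b::coded list)"
  shows "computable (\<lambda>x. drop (f x) (g x))"
proof (rule computable_compose2[OF _ assms])
  have "enc (drop (fst p) (snd p)) = code_drop (pfst (enc p)) (psnd (enc p))"
    for p :: "nat \<times> 'b list"
    by (simp add: enc_prod_def enc_list_def code_drop_list_encode drop_map)
  then show "computable (\<lambda>p::nat \<times> 'b list. drop (fst p) (snd p))"
    by (intro computable_code[of "\<lambda>z. code_drop (pfst z) (psnd z)"] rec1_code_drop rec1_pfst rec1_psnd)
qed

lemmas computable_intros =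
  computable_id computable_const computable_fst computable_snd computable_Pair
  computable_Suc computable_add computable_prod_encode computable_enc
  computable_Cons computable_drop

section \<open>Membership, bounded quantification and mapping on lists\<close>

lemma semidec_member:
  assumes "computable f" "computable g"
  shows "semidec (\<lambda>x. f x \<in> set (g x))"
proof -
  have "semidec (\<lambda>x. \<exists>i ys. drop i (g x) = f x # ys)"
    by (intro semidec_ex semidec_eq computable_intros computable_compose1[OF assms(1)]
        computable_compose1[OF assms(2)])
  then show ?thesis
  proof (rule semidec_cong)
    show "(\<exists>i ys. drop i (g x) = f x # ys) \<longleftrightarrow> f x \<in> set (g x)" for x
      by (metis append_eq_conv_conj in_set_dropD list.set_intros(1) split_list)
  qed
qed

text \<open>Elements are the heads of nonempty suffixes. Positions past the end satisfy the first
  disjunct, so any bound above the length will do.\<close>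

lemma ball_set_iff_drop:
  assumes "length xs \<le> n"
  shows "(\<forall>y\<in>set xs. P y) \<longleftrightarrow> (\<forall>i<n. drop i xs = [] \<or> (\<exists>y ys. drop i xs = y # ys \<and> P y))"
proof
  assume P: "\<forall>y\<in>set xs. P y"
  show "\<forall>i<n. drop i xs = [] \<or> (\<exists>y ys. drop i xs = y # ys \<and> P y)"
    by (metis P in_set_dropD list.set_intros(1) list.exhaust)
next
  assume P: "\<forall>i<n. drop i xs = [] \<or> (\<exists>y ys. drop i xs = y # ys \<and> P y)"
  show "\<forall>y\<in>set xs. P y"
  proof
    fix y assume "y \<in> set xs"
    then obtain i where i: "i < length xs" "xs ! i = y" by (auto simp: in_set_conv_nth)
    then have "drop i xs = y # drop (Suc i) xs" using Cons_nth_drop_Suc[OF i(1)] by simp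
    moreover from i assms have "i < n" by simp
    ultimately show "P y" using P by force
  qed
qed

lemma semidec_ball_set:
  assumes "semidec (\<lambda>p. P (fst p) (snd p))" "computable g"
  shows "semidec (\<lambda>x. \<forall>y\<in>set (g x). P x y)"
proof -
  have "semidec (\<lambda>x. \<forall>i<enc (g x). drop i (g x) = [] \<or> (\<exists>y ys. drop i (g x) = y # ys \<and> P x y))"
    by (intro semidec_ball_less semidec_disj semidec_conj semidec_ex semidec_eq computable_intros
        computable_compose1[OF assms(2)] semidec_compose2[OF assms(1)])
  then show ?thesis
    by (rule semidec_cong) (rule ball_set_iff_drop[OF length_le_enc, symmetric])
qed

text \<open>The lists are compared suffix by suffix. If their lengths differ, the position where the
  shorter one is exhausted lies below \<open>n\<close> and violates both disjuncts.\<close>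

lemma map_iff_drop:
  assumes "length xs < n" "length ys < n"
  shows "ys = map f xs \<longleftrightarrow> (\<forall>i<n. drop i xs = [] \<and> drop i ys = [] \<or>
     (\<exists>a as b bs. drop i xs = a # as \<and> drop i ys = b # bs \<and> b = f a))"
  using assms
proof (induction xs arbitrary: ys n)
  case Nil
  show ?case
  proof
    assume *: "\<forall>i<n. drop i [] = [] \<and> drop i ys = [] \<or>
       (\<exists>a as b bs. drop i [] = a # as \<and> drop i ys = b # bs \<and> b = f a)"
    from *[rule_format, of 0] Nil show "ys = map f []" by simp
  qed simp
next
  case (Cons x xs)
  then obtain m where m: "n = Suc m" by (cases n) auto
  show ?case
  proof (cases ys)
    case Nil
    have "\<not> (drop 0 (x # xs) = [] \<and> drop 0 ys = [] \<or>
       (\<exists>a as b bs. drop 0 (x # xs) = a # as \<and> drop 0 ys = b # bs \<and> b = f a))"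
      using Nil by simp
    then show ?thesis using Nil m by blast
  next
    case ys: (Cons y zs)
    have all: "(\<forall>i<Suc m. Q i) \<longleftrightarrow> Q 0 \<and> (\<forall>i<m. Q (Suc i))" for Q
      by (auto simp: less_Suc_eq_0_disj)
    have "zs = map f xs \<longleftrightarrow> (\<forall>i<m. drop i xs = [] \<and> drop i zs = [] \<or>
     (\<exists>a as b bs. drop i xs = a # as \<and> drop i zs = b # bs \<and> b = f a))"
      using Cons.prems m ys by (intro Cons.IH) auto
    then show ?thesis unfolding m all ys by simp
  qed
qed

lemma computable_map:
  assumes "computable (\<lambda>p. f (fst p) (snd p))" "computable g"
  shows "computable (\<lambda>x. map (f x) (g x))"
proof -
  let ?Q = "\<lambda>x ys i. drop i (g x) = [] \<and> drop i ys = [] \<or>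
     (\<exists>a as b bs. drop i (g x) = a # as \<and> drop i ys = b # bs \<and> b = f x a)"
  have "semidec (\<lambda>p. \<forall>i<Suc (enc (g (fst p)) + enc (snd p)). ?Q (fst p) (snd p) i)"
    by (intro semidec_ball_less semidec_disj semidec_conj semidec_ex semidec_eq computable_intros
        computable_compose1[OF assms(2)] computable_compose2[OF assms(1)])
  then show ?thesis
    unfolding computable_def
  proof (rule semidec_cong)
    fix p
    show "(\<forall>i<Suc (enc (g (fst p)) + enc (snd p)). ?Q (fst p) (snd p) i) \<longleftrightarrow>
        snd p = map (f (fst p)) (g (fst p))"
      using length_le_enc[of "g (fst p)"] length_le_enc[of "snd p"]
      by (intro map_iff_drop[symmetric]) auto
  qed
qed


section \<open>Inductive definitions\<close>

text \<open>The step \<open>S ps c\<close> says that \<open>c\<close> follows from the premises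
  \<open>ps\<close>; giving the premises as a finite list is what makes derivations codable.\<close>

inductive cl :: "('a list \<Rightarrow> 'a \<Rightarrow> bool) \<Rightarrow> 'a \<Rightarrow> bool" for S where
  clI: "S ps c \<Longrightarrow> (\<And>p. p \<in> set ps \<Longrightarrow> cl S p) \<Longrightarrow> cl S c"

text \<open>Derivations grow at the head: the premises of an entry occur behind it.\<close>

primrec derivation :: "('a list \<Rightarrow> 'a \<Rightarrow> bool) \<Rightarrow> 'a list \<Rightarrow> bool" where
  "derivation S [] \<longleftrightarrow> True"
| "derivation S (y # zs) \<longleftrightarrow> (\<exists>ps. S ps y \<and> (\<forall>p\<in>set ps. p \<in> set zs)) \<and> derivation S zs"

lemma derivation_append: "derivation S xs \<Longrightarrow> derivation S ys \<Longrightarrow> derivation S (xs @ ys)"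
  by (induction xs) auto

lemma derivation_imp_cl: "derivation S xs \<Longrightarrow> x \<in> set xs \<Longrightarrow> cl S x"
  by (induction xs arbitrary: x) (auto intro: clI)

text \<open>Derivations of the premises are concatenated, which keeps every premise behind its
  conclusion, and \<open>c\<close> is put in front.\<close>

lemma cl_imp_derivation: "cl S c \<Longrightarrow> \<exists>zs. derivation S (c # zs)"
proof (induction rule: cl.induct)
  case (clI ps c)
  have "\<forall>p\<in>set qs. \<exists>zs. derivation S (p # zs) \<Longrightarrow> \<exists>zs. derivation S zs \<and> set qs \<subseteq> set zs" for qs
  proof (induction qs)
    case (Cons q qs)
    then obtain xs ys where "derivation S xs" "set qs \<subseteq> set xs" "derivation S (q # ys)" by auto
    then have "derivation S ((q # ys) @ xs) \<and> set (q # qs) \<subseteq> set ((q # ys) @ xs)"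
      by (intro conjI derivation_append) auto
    then show ?case by blast
  qed (auto intro: exI[of _ "[]"])
  with clI obtain zs where "derivation S zs" "set ps \<subseteq> set zs" by blast
  with clI(1) have "derivation S (c # zs)" by auto
  then show ?case ..
qed

text \<open>Being a derivation is a local condition on each suffix, hence expressible by a bounded
  quantifier.\<close>

lemma derivation_iff_drop:
  assumes "length xs \<le> n"
  shows "derivation S xs \<longleftrightarrow> (\<forall>i<n. drop i xs = [] \<or>
     (\<exists>y zs ps. drop i xs = y # zs \<and> S ps y \<and> (\<forall>p\<in>set ps. p \<in> set zs)))"
  using assms
proof (induction xs arbitrary: n)
  case (Cons x xs)
  then obtain m where m: "n = Suc m" by (cases n) auto
  have all: "(\<forall>i<Suc m. Q i) \<longleftrightarrow> Q 0 \<and> (\<forall>i<m. Q (Suc i))" for Q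
    by (auto simp: less_Suc_eq_0_disj)
  have "derivation S xs \<longleftrightarrow> (\<forall>i<m. drop i xs = [] \<or>
     (\<exists>y zs ps. drop i xs = y # zs \<and> S ps y \<and> (\<forall>p\<in>set ps. p \<in> set zs)))"
    using Cons.prems m by (intro Cons.IH) auto
  then show ?case unfolding m all by simp
qed simp

text \<open>Membership amounts to the existence of a derivation headed by \<open>c\<close>, and the
  list \<open>xs\<close> searched for can be checked with bounded quantifiers.\<close>

theorem semidec_cl:
  assumes "semidec (\<lambda>p. S (fst p) (snd p))"
  shows "semidec (cl S)"
proof -
  have "semidec (\<lambda>c. \<exists>xs ys. xs = c # ys \<and> (\<forall>i<enc xs. drop i xs = [] \<or>
     (\<exists>y zs ps. drop i xs = y # zs \<and> S ps y \<and> (\<forall>p\<in>set ps. p \<in> set zs))))"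
    by (intro semidec_ball_less semidec_disj semidec_conj semidec_ex semidec_eq computable_intros
        semidec_ball_set semidec_member
        semidec_compose2[OF assms])
  then show ?thesis
  proof (rule semidec_cong)
    fix c
    have "derivation S xs \<longleftrightarrow> (\<forall>i<enc xs. drop i xs = [] \<or>
     (\<exists>y zs ps. drop i xs = y # zs \<and> S ps y \<and> (\<forall>p\<in>set ps. p \<in> set zs)))" for xs
      by (rule derivation_iff_drop[OF length_le_enc])
    then show "(\<exists>xs ys. xs = c # ys \<and> (\<forall>i<enc xs. drop i xs = [] \<or>
     (\<exists>y zs ps. drop i xs = y # zs \<and> S ps y \<and> (\<forall>p\<in>set ps. p \<in> set zs)))) \<longleftrightarrow> cl S c"
      using cl_imp_derivation derivation_imp_cl by (metis list.set_intros(1))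
  qed
qed

section \<open>Terms and formulas\<close>

instantiation tm :: coded
begin
definition enc_tm :: "tm \<Rightarrow> nat" where "enc_tm = tm_code"
instance
proof
  show "enc s = enc t \<Longrightarrow> s = t" for s t :: tm
    by (simp add: enc_tm_def tm_code_inject)
next
  \<comment> \<open>Term formation read on bare codes, as terms are not yet a coded type. In the
    second case the premises are the codes of the arguments.\<close>
  define S where "S ps c \<longleftrightarrow> (\<exists>i::nat. c = enc [0, i]) \<or> (\<exists>f. c = enc ((1::nat) # f # ps))"
    for ps :: "nat list" and c :: nat
  have "semidec (\<lambda>p. S (fst p) (snd p))"
    unfolding S_def by (intro semidec_disj semidec_ex semidec_eq computable_intros)
  then have "semidec (cl S)" by (rule semidec_cl)
  then show "re (\<lambda>c. \<exists>t. c = enc (t :: tm))"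
    unfolding re_iff_semidec
  proof (rule semidec_cong)
    fix c
    show "cl S c \<longleftrightarrow> (\<exists>t. c = enc (t :: tm))"
    proof
      assume "cl S c"
      then show "\<exists>t. c = enc (t :: tm)"
      proof induction
        case (clI ps c)
        from clI(1) consider i where "c = enc [0, i :: nat]" | f where "c = enc ((1::nat) # f # ps)"
          unfolding S_def by blast
        then show ?case
        proof cases
          case 1
          then have "c = enc (Var i)" by (simp add: enc_tm_def)
          then show ?thesis ..
        next
          case 2
          from clI(3) obtain t where t: "\<And>p. p \<in> set ps \<Longrightarrow> tm_code (t p) = p"
            unfolding enc_tm_def by metis
          then have "map tm_code (map t ps) = ps" by (simp add: map_idI)
          then have "c = enc (Fun f (map t ps))"
            using 2 by (simp add: enc_tm_def enc_nat_list del: enc_Cons map_map)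
          then show ?thesis ..
        qed
      qed
    next
      assume "\<exists>t. c = enc (t :: tm)"
      then obtain t where "c = tm_code t" by (auto simp: enc_tm_def)
      moreover have "cl S (tm_code t)"
      proof (induction t)
        case (Var i)
        show ?case by (rule clI[of _ "[]"]) (auto simp: S_def)
      next
        case (Fun f ts)
        show ?case
        proof (rule clI[of S "map tm_code ts"])
          show "S (map tm_code ts) (tm_code (Fun f ts))"
            by (auto simp: S_def enc_nat_list simp del: enc_Cons)
        qed (use Fun in auto)
      qed
      ultimately show "cl S c" by simp
    qed
  qed
qed
end

lemma enc_Var [simp]: "enc (Var i) = Suc (prod_encode (0, Suc (prod_encode (i, 0))))"
  by (simp add: enc_tm_def)

lemma enc_Fun [simp]: "enc (Fun f ts) = Suc (prod_encode (1, Suc (prod_encode (f, enc ts))))"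
  by (simp add: enc_tm_def enc_list_def)

lemma computable_Var: "computable f \<Longrightarrow> computable (\<lambda>x. Var (f x))"
  by (rule computable_via_enc) (simp, intro computable_intros)

lemma computable_Fun: "computable f \<Longrightarrow> computable g \<Longrightarrow> computable (\<lambda>x. Fun (f x) (g x))"
  by (rule computable_via_enc) (simp, intro computable_intros)

instantiation fm :: coded
begin
definition enc_fm :: "fm \<Rightarrow> nat" where "enc_fm = fm_code"
instance
proof
  show "enc p = enc q \<Longrightarrow> p = q" for p q :: fm
    using inj_fm_code by (simp add: enc_fm_def inj_eq)
next
  \<comment> \<open>Formula formation on codes. Terms are already coded, so atomic formulas take no
    premises. The \<open>Rel\<close> case spells out the head of the list code because its tail
    \<open>enc ts\<close> is the code of a list of terms.\<close>
  define S where "S ps c \<longleftrightarrow>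
      (\<exists>s t. c = enc [0, enc (s::tm), enc (t::tm)]) \<or>
      (\<exists>r ts. c = Suc (prod_encode (1, Suc (prod_encode (r, enc (ts :: tm list)))))) \<or>
      c = enc [2::nat] \<or>
      (\<exists>p q. ps = [p, q] \<and> c = enc [3, p, q]) \<or>
      (\<exists>p. ps = [p] \<and> c = enc [4, p])"
    for ps :: "nat list" and c :: nat
  have "semidec (\<lambda>p. S (fst p) (snd p))"
    unfolding S_def by (intro semidec_disj semidec_ex semidec_conj semidec_eq computable_intros)
  then have "semidec (cl S)" by (rule semidec_cl)
  then show "re (\<lambda>c. \<exists>p. c = enc (p :: fm))"
    unfolding re_iff_semidec
  proof (rule semidec_cong)
    fix c
    show "cl S c \<longleftrightarrow> (\<exists>p. c = enc (p :: fm))"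
    proof
      assume "cl S c"
      then show "\<exists>p. c = enc (p :: fm)"
      proof induction
        case (clI ps c)
        from clI(1) consider s t where "c = fm_code (Eq s t)" | r ts where "c = fm_code (Rel r ts)"
          | "c = fm_code Bot"
          | p q where "ps = [p, q]" "c = list_encode [3, p, q]"
          | p where "ps = [p]" "c = list_encode [4, p]"
          unfolding S_def by (auto simp: enc_tm_def enc_list_def)
        then show ?case
        proof cases
          case 4
          with clI(3) obtain a b where "p = fm_code a" "q = fm_code b"
            unfolding enc_fm_def by (metis list.set_intros)
          with 4 have "c = enc (Imp a b)" by (simp add: enc_fm_def)
          then show ?thesis ..
        next
          case 5
          with clI(3) obtain a where "p = fm_code a"
            unfolding enc_fm_def by (metis list.set_intros(1))
          with 5 have "c = enc (All a)" by (simp add: enc_fm_def)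
          then show ?thesis ..
        qed (auto simp: enc_fm_def simp del: fm_code.simps)
      qed
    next
      assume "\<exists>p. c = enc (p :: fm)"
      then obtain p where "c = fm_code p" by (auto simp: enc_fm_def)
      moreover have "cl S (fm_code p)"
      proof (induction p)
        case (Eq s t)
        show ?case by (rule clI[of _ "[]"]) (auto simp: S_def enc_tm_def)
      next
        case (Rel r ts)
        show ?case by (rule clI[of _ "[]"]) (auto simp: S_def enc_tm_def enc_list_def)
      next
        case Bot
        show ?case by (rule clI[of _ "[]"]) (auto simp: S_def)
      next
        case (Imp p q)
        have "S [fm_code p, fm_code q] (fm_code (Imp p q))"
          by (simp add: S_def)
        then show ?case by (rule clI) (use Imp in auto)
      next
        case (All p)
        have "S [fm_code p] (fm_code (All p))"
          by (simp add: S_def)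
        then show ?case by (rule clI) (use All in auto)
      qed
      ultimately show "cl S c" by simp
    qed
  qed
qed
end

lemma enc_fm_simps [simp]:
  "enc (Eq s t) = Suc (prod_encode (0, Suc (prod_encode (enc s, Suc (prod_encode (enc t, 0))))))"
  "enc (Rel r ts) = Suc (prod_encode (1, Suc (prod_encode (r, enc ts))))"
  "enc (Imp p q) = Suc (prod_encode (3, Suc (prod_encode (enc p, Suc (prod_encode (enc q, 0))))))"
  "enc (All p) = Suc (prod_encode (4, Suc (prod_encode (enc p, 0))))"
  by (simp_all add: enc_fm_def enc_tm_def enc_list_def)

lemma computable_Eq: "computable f \<Longrightarrow> computable g \<Longrightarrow> computable (\<lambda>x. Eq (f x) (g x))"
  by (rule computable_via_enc) (simp, intro computable_intros)

lemma computable_Rel: "computable f \<Longrightarrow> computable g \<Longrightarrow> computable (\<lambda>x. Rel (f x) (g x))"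
  by (rule computable_via_enc) (simp, intro computable_intros)

lemma computable_Imp: "computable f \<Longrightarrow> computable g \<Longrightarrow> computable (\<lambda>x. Imp (f x) (g x))"
  by (rule computable_via_enc) (simp, intro computable_intros)

lemma computable_All: "computable f \<Longrightarrow> computable (\<lambda>x. All (f x))"
  by (rule computable_via_enc) (simp, intro computable_intros)

lemmas computable_fm_intros =
  computable_Var computable_Fun computable_Eq computable_Rel computable_Imp computable_All

text \<open>A substitution is a function and has no code, so it enters through a coded parameter
  \<open>s\<close>. The graph is the closure of a step relation on triples of parameter, term and
  result.\<close>

lemma computable_subst_tm:
  fixes \<sigma> :: "'s::coded \<Rightarrow> nat \<Rightarrow> tm"
  assumes "computable (\<lambda>p. \<sigma> (fst p) (snd p))"
  shows "computable (\<lambda>p. subst_tm (\<sigma> (fst p)) (snd p))"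
proof -
  define S where "S ps c \<longleftrightarrow>
      (\<exists>i. fst (snd c) = Var i \<and> snd (snd c) = \<sigma> (fst c) i) \<or>
      (\<exists>f. fst (snd c) = Fun f (map (\<lambda>p. fst (snd p)) ps) \<and>
        snd (snd c) = Fun f (map (\<lambda>p. snd (snd p)) ps) \<and> (\<forall>p\<in>set ps. fst p = fst c))"
    for ps and c :: "'s \<times> tm \<times> tm"
  have "semidec (\<lambda>p. S (fst p) (snd p))"
    unfolding S_def
    by (intro semidec_disj semidec_ex semidec_conj semidec_eq semidec_ball_set computable_map
        computable_intros computable_fm_intros computable_compose2[OF assms])
  then have "semidec (cl S)" by (rule semidec_cl)
  from semidec_compose[OF this, of "\<lambda>p. (fst (fst p), snd (fst p), snd p)"]
  have "semidec (\<lambda>p. cl S (fst (fst p), snd (fst p), snd p))"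
    by (simp add: computable_intros)
  moreover have "u = subst_tm (\<sigma> s) t" if "cl S (s, t, u)" for s t u
  proof -
    have "snd (snd c) = subst_tm (\<sigma> (fst c)) (fst (snd c))" if "cl S c" for c
      using that
    proof induction
      case (clI ps c)
      have "map (\<lambda>p. snd (snd p)) ps = map (subst_tm (\<sigma> (fst c))) (map (\<lambda>p. fst (snd p)) ps)"
        if "\<forall>p\<in>set ps. fst p = fst c"
        using clI(3) that by auto
      with clI(1) show ?case
        unfolding S_def by (elim disjE exE conjE) simp_all
    qed
    from this[OF that] show ?thesis by simp
  qed
  moreover have "cl S (s, t, subst_tm (\<sigma> s) t)" for s t
  proof (induction t)
    case (Var i)
    show ?case by (rule clI[of _ "[]"]) (auto simp: S_def)
  next
    case (Fun f ts)
    show ?case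
    proof (rule clI[of S "map (\<lambda>t. (s, t, subst_tm (\<sigma> s) t)) ts"])
      show "S (map (\<lambda>t. (s, t, subst_tm (\<sigma> s) t)) ts) (s, Fun f ts, subst_tm (\<sigma> s) (Fun f ts))"
        by (simp add: S_def comp_def)
    qed (use Fun in auto)
  qed
  ultimately show ?thesis
    unfolding computable_def by (elim semidec_cong) auto
qed

text \<open>Under a quantifier the substitution is lifted. The function \<open>up\<close> expresses
  this lifting on parameters, so that the recursion stays inside one family of
  substitutions.\<close>

lemma computable_subst:
  fixes \<sigma> :: "'s::coded \<Rightarrow> nat \<Rightarrow> tm" and up :: "'s \<Rightarrow> 's"
  assumes \<sigma>: "computable (\<lambda>p. \<sigma> (fst p) (snd p))" and up: "computable up"
    and \<sigma>_up: "\<And>s. \<sigma> (up s) = case_nat (Var 0) (\<lambda>i. subst_tm shift (\<sigma> s i))"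
  shows "computable (\<lambda>p. subst (\<sigma> (fst p)) (snd p))"
proof -
  define S where "S ps c \<longleftrightarrow>
      (\<exists>a b. fst (snd c) = Eq a b \<and>
        snd (snd c) = Eq (subst_tm (\<sigma> (fst c)) a) (subst_tm (\<sigma> (fst c)) b)) \<or>
      (\<exists>r ts. fst (snd c) = Rel r ts \<and> snd (snd c) = Rel r (map (subst_tm (\<sigma> (fst c))) ts)) \<or>
      fst (snd c) = Bot \<and> snd (snd c) = Bot \<or>
      (\<exists>a b a' b'. fst (snd c) = Imp a b \<and> snd (snd c) = Imp a' b' \<and>
        ps = [(fst c, a, a'), (fst c, b, b')]) \<or>
      (\<exists>a a'. fst (snd c) = All a \<and> snd (snd c) = All a' \<and> ps = [(up (fst c), a, a')])"
    for ps and c :: "'s \<times> fm \<times> fm"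
  have "semidec (\<lambda>p. S (fst p) (snd p))"
    unfolding S_def
    by (intro semidec_disj semidec_ex semidec_conj semidec_eq computable_map
        computable_intros computable_fm_intros computable_compose1[OF up]
        computable_compose2[OF computable_subst_tm[OF \<sigma>]])
  then have "semidec (cl S)" by (rule semidec_cl)
  from semidec_compose[OF this, of "\<lambda>p. (fst (fst p), snd (fst p), snd p)"]
  have "semidec (\<lambda>p. cl S (fst (fst p), snd (fst p), snd p))"
    by (simp add: computable_intros)
  moreover have "u = subst (\<sigma> s) t" if "cl S (s, t, u)" for s t u
  proof -
    have "snd (snd c) = subst (\<sigma> (fst c)) (fst (snd c))" if "cl S c" for c
      using that
    proof induction
      case (clI ps c)
      have "\<forall>p\<in>set ps. snd (snd p) = subst (\<sigma> (fst p)) (fst (snd p))"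
        using clI(3) by blast
      with clI(1) show ?case
        unfolding S_def by (elim disjE exE conjE) (simp_all add: \<sigma>_up)
    qed
    from this[OF that] show ?thesis by simp
  qed
  moreover have "cl S (s, p, subst (\<sigma> s) p)" for s p
  proof (induction p arbitrary: s)
    case (Eq a b)
    show ?case by (rule clI[of _ "[]"]) (auto simp: S_def)
  next
    case (Rel r ts)
    show ?case by (rule clI[of _ "[]"]) (auto simp: S_def)
  next
    case Bot
    show ?case by (rule clI[of _ "[]"]) (auto simp: S_def)
  next
    case (Imp a b)
    show ?case
    proof (rule clI[of S "[(s, a, subst (\<sigma> s) a), (s, b, subst (\<sigma> s) b)]"])
      show "S [(s, a, subst (\<sigma> s) a), (s, b, subst (\<sigma> s) b)] (s, Imp a b, subst (\<sigma> s) (Imp a b))"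
        by (simp add: S_def)
    qed (use Imp in auto)
  next
    case (All a)
    show ?case
    proof (rule clI[of S "[(up s, a, subst (\<sigma> (up s)) a)]"])
      show "S [(up s, a, subst (\<sigma> (up s)) a)] (s, All a, subst (\<sigma> s) (All a))"
        by (simp add: S_def \<sigma>_up)
    qed (use All in auto)
  qed
  ultimately show ?thesis
    unfolding computable_def by (elim semidec_cong) auto
qed

section \<open>The substitutions occurring in the calculus\<close>

lemma semidec_less:
  assumes "computable (f :: _ \<Rightarrow> nat)" "computable g"
  shows "semidec (\<lambda>x. f x < g x)"
proof -
  have "semidec (\<lambda>x. \<exists>d. g x = Suc (f x + d))"
    by (intro semidec_ex semidec_eq computable_compose1[OF assms(1)] computable_compose1[OF assms(2)]
        computable_intros)
  then show ?thesis by (rule semidec_cong) (auto simp: less_iff_Suc_add)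
qed

lemma computable_pred: "computable f \<Longrightarrow> computable (\<lambda>x. f x - Suc 0)"
  by (rule computable_compose1[of "\<lambda>n. n - Suc 0"], rule computable_code[OF rec1_pred]) simp_all

text \<open>The \<open>k\<close>-fold lifting under quantifiers of the substitution used by \<^const>\<open>inst0\<close>.\<close>

definition inst_at :: "nat \<times> tm \<Rightarrow> nat \<Rightarrow> tm" where
  "inst_at s i = (if i < fst s then Var i
     else if i = fst s then subst_tm (\<lambda>j. Var (j + fst s)) (snd s) else Var (i - Suc 0))"

lemma subst_tm_Var: "subst_tm Var t = t"
  by (induction t) (auto intro: map_idI)

lemma subst_tm_subst_tm: "subst_tm \<sigma> (subst_tm \<tau> t) = subst_tm (\<lambda>i. subst_tm \<sigma> (\<tau> i)) t"
  by (induction t) auto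

lemma inst_at_0: "inst_at (0, t) = case_nat t Var"
  by (rule HOL.ext) (auto simp: inst_at_def subst_tm_Var split: nat.split)

lemma inst_at_Suc:
  "inst_at (Suc k, t) = case_nat (Var 0) (\<lambda>i. subst_tm shift (inst_at (k, t) i))"
  by (rule HOL.ext) (auto simp: inst_at_def subst_tm_subst_tm split: nat.split)

text \<open>The conditional becomes a disjunction of positive cases, because semidecidable
  predicates are not closed under negation.\<close>

lemma computable_inst_at: "computable (\<lambda>p. inst_at (fst p) (snd p))"
proof -
  have 1: "computable (\<lambda>p. subst_tm (\<lambda>j. Var (j + fst p)) (snd p))"
    using computable_subst_tm[of "\<lambda>k j. Var (j + k)"]
    by (simp add: computable_intros computable_fm_intros)
  have "semidec (\<lambda>p. snd (fst p) < fst (fst (fst p)) \<and> snd p = Var (snd (fst p)) \<or>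
      snd (fst p) = fst (fst (fst p)) \<and>
        snd p = subst_tm (\<lambda>j. Var (j + fst (fst (fst p)))) (snd (fst (fst p))) \<or>
      fst (fst (fst p)) < snd (fst p) \<and> snd p = Var (snd (fst p) - Suc 0))"
    by (intro semidec_disj semidec_conj semidec_less semidec_eq computable_intros
        computable_fm_intros computable_pred
        computable_compose2[OF 1])
  then show ?thesis
    unfolding computable_def by (rule semidec_cong) (auto simp: inst_at_def)
qed

lemma computable_inst0:
  assumes "computable f" "computable g"
  shows "computable (\<lambda>x. inst0 (f x) (g x))"
proof -
  have "computable (\<lambda>p. subst (inst_at (fst p)) (snd p))"
  proof (rule computable_subst[OF computable_inst_at])
    show "computable (\<lambda>s. (Suc (fst s), snd s) :: nat \<times> tm)" by (intro computable_intros)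
  qed (simp add: inst_at_Suc)
  from computable_compose2[OF this computable_Pair[OF computable_const[of 0] assms(1)] assms(2)]
  show ?thesis by (simp add: inst_at_0)
qed

lemma computable_subst_shift:
  assumes "computable f"
  shows "computable (\<lambda>x. subst shift (f x))"
proof -
  \<comment> \<open>The \<open>k\<close>-fold lifting of \<open>shift\<close>: the \<open>k\<close>
    variables bound by the quantifiers passed so far stay fixed.\<close>
  define \<sigma> where "\<sigma> k i = (if i < k then Var i else Var (Suc i))" for k i :: nat
  have "semidec (\<lambda>p. snd (fst p) < fst (fst p) \<and> snd p = Var (snd (fst p)) \<or>
      fst (fst p) < Suc (snd (fst p)) \<and> snd p = Var (Suc (snd (fst p))))"
    by (intro semidec_disj semidec_conj semidec_less semidec_eq computable_intros
        computable_fm_intros)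
  then have 1: "computable (\<lambda>p. \<sigma> (fst p) (snd p))"
    unfolding computable_def by (rule semidec_cong) (auto simp: \<sigma>_def)
  have 2: "\<sigma> (Suc k) = case_nat (Var 0) (\<lambda>i. subst_tm shift (\<sigma> k i))" for k
    by (rule HOL.ext) (auto simp: \<sigma>_def split: nat.split)
  have "computable (\<lambda>p. subst (\<sigma> (fst p)) (snd p))"
    by (rule computable_subst[OF 1 computable_Suc[OF computable_id] 2])
  from computable_compose2[OF this computable_const[of 0] assms]
  show ?thesis by (simp add: \<sigma>_def)
qed

text \<open>Every axiom scheme and every rule contributes one disjunct to the step relation. The
  schemes with substitution are covered by computability of instantiation and shifting.\<close>

theorem semidec_derivable:
  assumes "semidec (\<lambda>p. p \<in> A)"
  shows "semidec (derivable A)"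
proof -
  define S where "S ps p \<longleftrightarrow>
      p \<in> A \<or>
      (\<exists>a b. p = Imp a (Imp b a)) \<or>
      (\<exists>a b c. p = Imp (Imp a (Imp b c)) (Imp (Imp a b) (Imp a c))) \<or>
      (\<exists>a. p = Imp (Neg (Neg a)) a) \<or>
      (\<exists>a t. p = Imp (All a) (inst0 t a)) \<or>
      (\<exists>a b. p = Imp (All (Imp a b)) (Imp (All a) (All b))) \<or>
      (\<exists>a. p = Imp a (All (subst shift a))) \<or>
      (\<exists>t. p = Eq t t) \<or>
      (\<exists>s t a. p = Imp (Eq s t) (Imp (inst0 s a) (inst0 t a))) \<or>
      (\<exists>q. ps = [Imp q p, q]) \<or>
      (\<exists>q. ps = [q] \<and> p = All q)" for ps p
  have "semidec (\<lambda>p. S (fst p) (snd p))"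
    unfolding S_def
    by (intro semidec_disj semidec_ex semidec_conj semidec_eq semidec_compose[OF assms]
        computable_inst0 computable_subst_shift computable_intros computable_fm_intros)
  then have "semidec (cl S)" by (rule semidec_cl)
  then show ?thesis
  proof (rule semidec_cong)
    fix p
    show "cl S p \<longleftrightarrow> derivable A p"
    proof
      show "cl S p \<Longrightarrow> derivable A p"
      proof (induction rule: cl.induct)
        case (clI ps p)
        from clI(1,3) show ?case
          unfolding S_def by (elim disjE exE conjE) (auto intro: derivable.intros)
      qed
    next
      show "derivable A p \<Longrightarrow> cl S p"
      proof (induction rule: derivable.induct)
        case (mp p q)
        have "S [Imp p q, p] q" by (simp add: S_def)
        then show ?case by (rule clI) (use mp in auto)
      next
        case (gen p)
        have "S [p] (All p)" by (simp add: S_def)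
        then show ?case by (rule clI) (use gen in auto)
      qed (rule clI[of S "[]"], simp add: S_def, blast?, simp)+
    qed
  qed
qed

section \<open>Numerals\<close>

text \<open>Recursion with values in any coded type: the graph is a closure in which each pair has
  its predecessor as sole premise.\<close>

lemma computable_iterate:
  assumes "g 0 = a" "\<And>n. g (Suc n) = h (g n)" "computable h"
  shows "computable g"
proof -
  define S where "S ps c \<longleftrightarrow> fst c = 0 \<and> snd c = a \<or>
      (\<exists>m z. fst c = Suc m \<and> snd c = h z \<and> ps = [(m, z)])" for ps and c :: "nat \<times> 'a"
  have "semidec (\<lambda>p. S (fst p) (snd p))"
    unfolding S_def
    by (intro semidec_disj semidec_ex semidec_conj semidec_eq computable_intros
        computable_compose1[OF assms(3)])
  then have "semidec (cl S)" by (rule semidec_cl)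
  moreover have "snd c = g (fst c)" if "cl S c" for c
    using that
  proof induction
    case (clI ps c)
    from clI(1) show ?case
      unfolding S_def by (elim disjE exE conjE) (use clI(3) assms(1,2) in auto)
  qed
  moreover have "cl S (n, g n)" for n
  proof (induction n)
    case 0
    have "S [] (0, g 0)" by (simp add: S_def assms)
    then show ?case by (rule clI) auto
  next
    case (Suc n)
    have "S [(n, g n)] (Suc n, g (Suc n))" by (simp add: S_def assms)
    then show ?case by (rule clI) (use Suc in auto)
  qed
  ultimately show ?thesis
    unfolding computable_def by (elim semidec_cong) auto
qed

text \<open>Numerals are closed, so the renaming, which changes under each quantifier of the
  translation, has no effect.\<close>

lemma tr_tm_numeral_tm_cong: "tr_tm I \<rho> (numeral_tm k) y = tr_tm I \<rho>' (numeral_tm k) y"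
  by (induction k arbitrary: \<rho> \<rho>' y) auto

lemma computable_tr_tm_numeral_tm: "computable (\<lambda>k. tr_tm I \<rho> (numeral_tm k) y)"
proof -
  \<comment> \<open>Inner numerals are always translated with target variable 0, so \<open>N\<close>
    obeys a recursion with a fixed step; the target \<open>y\<close> enters only in the outermost
    layer.\<close>
  define N where "N k = tr_tm I \<rho> (numeral_tm k) 0" for k
  have suc: "tr_tm I \<rho> (numeral_tm (Suc k)) y =
      Ex (Conj (at1 (domF I) 0) (Conj (N k) (at2 (sucF I) 0 (Suc y))))" for k y
    by (simp add: N_def tr_tm_numeral_tm_cong[of I "\<lambda>i. Suc (\<rho> i)" k 0 \<rho>])
  have N: "computable N"
    by (rule computable_iterate[where a = "at1 (zeroF I) 0"
          and h = "\<lambda>q. Ex (Conj (at1 (domF I) 0) (Conj q (at2 (sucF I) 0 (Suc 0))))"])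
      (simp add: N_def, simp only: N_def[of "Suc _"] suc, intro computable_intros computable_fm_intros)
  have "semidec (\<lambda>p. fst p = 0 \<and> snd p = at1 (zeroF I) y \<or>
      (\<exists>k. fst p = Suc k \<and>
        snd p = Ex (Conj (at1 (domF I) 0) (Conj (N k) (at2 (sucF I) 0 (Suc y))))))"
    by (intro semidec_disj semidec_ex semidec_conj semidec_eq computable_compose1[OF N]
        computable_intros computable_fm_intros)
  then show ?thesis
    unfolding computable_def
  proof (rule semidec_cong)
    fix p :: "nat \<times> fm"
    show "fst p = 0 \<and> snd p = at1 (zeroF I) y \<or>
      (\<exists>k. fst p = Suc k \<and>
        snd p = Ex (Conj (at1 (domF I) 0) (Conj (N k) (at2 (sucF I) 0 (Suc y))))) \<longleftrightarrow>
      snd p = tr_tm I \<rho> (numeral_tm (fst p)) y"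
      by (cases "fst p") (simp_all only: suc, simp_all)
  qed
qed

text \<open>A total version of \<open>nth\<close>, which is unspecified beyond the end of the list.\<close>

definition code_nth :: "nat \<Rightarrow> nat \<Rightarrow> nat" where
  "code_nth i c = pfst (code_drop i c - 1)"

lemma code_nth_enc: "i < length xs \<Longrightarrow> code_nth i (enc xs) = xs ! i"
  using Cons_nth_drop_Suc[of i xs, symmetric]
  by (simp add: code_nth_def enc_nat_list code_drop_list_encode)

lemma rec1_code_nth: "rec1 f \<Longrightarrow> rec1 (\<lambda>x. code_nth i (f x))"
  unfolding code_nth_def by (intro rec1_intros rec1_code_drop)

lemma computable_foldr_Conj:
  assumes "\<And>i. i \<in> set is \<Longrightarrow> computable (k i)" "computable p"
  shows "computable (\<lambda>x. foldr Conj (map (\<lambda>i. k i x) is) (p x))"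
  using assms(1) by (induction "is") (simp_all add: assms(2) computable_const computable_Imp)

lemma computable_Ex_power: "computable p \<Longrightarrow> computable (\<lambda>x. (Ex ^^ n) (p x))"
  by (induction n) (simp_all add: computable_const computable_Imp computable_All)

lemma semidec_length: "computable f \<Longrightarrow> semidec (\<lambda>x. length (f x) = n)"
proof -
  have "semidec (\<lambda>xs :: 'b list. length xs = n)"
  proof (induction n)
    case 0
    have "semidec (\<lambda>xs :: 'b list. xs = [])"
      by (intro semidec_eq computable_intros)
    then show ?case by simp
  next
    case (Suc n)
    have "semidec (\<lambda>xs :: 'b list. \<exists>y ys. xs = y # ys \<and> length ys = n)"
      by (intro semidec_ex semidec_conj semidec_eq computable_intros semidec_compose[OF Suc])
    then show ?case by (simp add: length_Suc_conv)
  qed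
  then show "computable f \<Longrightarrow> semidec (\<lambda>x. length (f x) = n)"
    by (rule semidec_compose)
qed

lemma semidec_at_numerals:
  assumes "semidec P" "computable f" "computable g"
  shows "semidec (\<lambda>x. length (g x) = n \<and> P (at_numerals I (f x) (g x)))"
proof -
  \<comment> \<open>With \<open>n\<close> fixed and \<open>code_nth\<close> in place of
    \<open>!\<close>, this is computable on all inputs; it agrees with \<open>at_numerals\<close> on
    lists of length \<open>n\<close>.\<close>
  let ?F = "\<lambda>x. (Ex ^^ n) (foldr Conj (map (\<lambda>i. Conj (at1 (domF I) i)
    (tr_tm I (\<lambda>j. j) (numeral_tm (code_nth i (enc (g x)))) i)) [0..<n]) (f x))"
  have nth: "computable (code_nth i)" for i
    by (rule computable_code[OF rec1_code_nth[OF rec1_id]]) simp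
  have "computable ?F"
    by (intro computable_Ex_power computable_foldr_Conj computable_Imp computable_const
        computable_compose1[OF computable_tr_tm_numeral_tm] computable_compose1[OF nth]
        computable_enc assms(2,3))
  then have "semidec (\<lambda>x. length (g x) = n \<and> P (?F x))"
    by (intro semidec_conj semidec_length assms(3) semidec_compose[OF assms(1)])
  then show ?thesis
  proof (rule semidec_cong)
    fix x
    have "?F x = at_numerals I (f x) (g x)" if "length (g x) = n"
    proof -
      have "map (\<lambda>i. Conj (at1 (domF I) i)
          (tr_tm I (\<lambda>j. j) (numeral_tm (code_nth i (enc (g x)))) i)) [0..<n] =
        map (\<lambda>i. Conj (at1 (domF I) i) (tr_tm I (\<lambda>j. j) (numeral_tm (g x ! i)) i)) [0..<n]"
        by (rule map_cong) (simp_all add: code_nth_enc that)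
      then show ?thesis by (simp only: at_numerals_def that)
    qed
    then show "length (g x) = n \<and> P (?F x) \<longleftrightarrow> length (g x) = n \<and> P (at_numerals I (f x) (g x))"
      by auto
  qed
qed


section \<open>RE relations and the recursion theorem\<close>

text \<open>The witness and the entries, separate arguments of \<open>f\<close>, are recovered from
  a single number.\<close>

lemma RE_imp_semidec:
  assumes "RE k A"
  shows "semidec (\<lambda>xs. xs \<in> A)"
proof -
  obtain f where f: "recursive (Suc k) f"
    and A: "A = {xs. length xs = k \<and> (\<exists>y. f (y # xs) = 0)}"
    using assms unfolding RE_def by blast
  \<comment> \<open>From a number coding a pair these functions extract the \<open>k + 1\<close>
    arguments of \<open>f\<close>: first the witness, then the entries of the coded list.\<close>
  let ?hs = "(\<lambda>xs. pfst (xs ! 0)) # map (\<lambda>i xs. code_nth i (psnd (xs ! 0))) [0..<k]"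
  have hs: "recursive 1 h" if "h \<in> set ?hs" for h
  proof -
    have "rec1 pfst" "rec1 (\<lambda>x. code_nth i (psnd x))" for i
      by (intro rec1_pfst rec1_code_nth rec1_psnd)+
    with that show ?thesis by (auto simp: rec1_def)
  qed
  have "recursive 1 (\<lambda>xs. f (map (\<lambda>h. h xs) ?hs))"
    by (rule recursive.comp[OF _ hs]) (simp_all add: f)
  then have "rec1 (\<lambda>z. f (pfst z # map (\<lambda>i. code_nth i (psnd z)) [0..<k]))"
    by (simp add: rec1_def comp_def)
  then have "re (\<lambda>c. \<exists>y. f (y # map (\<lambda>i. code_nth i c) [0..<k]) = 0)"
    by (rule reI) simp
  then have "semidec (\<lambda>xs :: nat list. length xs = k \<and>
      (\<exists>y. f (y # map (\<lambda>i. code_nth i (enc xs)) [0..<k]) = 0))"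
    unfolding re_iff_semidec
    by (intro semidec_conj semidec_length computable_id
        semidec_compose[where f = enc and P = "\<lambda>c. \<exists>y. f (y # map (\<lambda>i. code_nth i c) [0..<k]) = 0"]
        computable_enc)
  then show ?thesis
  proof (rule semidec_cong)
    fix xs :: "nat list"
    have "map (\<lambda>i. code_nth i (enc xs)) [0..<k] = xs" if "length xs = k"
      by (rule nth_equalityI) (simp_all add: that code_nth_enc)
    then show "length xs = k \<and> (\<exists>y. f (y # map (\<lambda>i. code_nth i (enc xs)) [0..<k]) = 0) \<longleftrightarrow> xs \<in> A"
      by (auto simp: A)
  qed
qed

text \<open>For a fixed arity the code of the argument list is built from its end, by induction from
  \<open>k\<close> down to \<open>j\<close>.\<close>

lemma recursive_list_encode_drop: "j \<le> k \<Longrightarrow> recursive k (\<lambda>xs. list_encode (drop j xs))"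
proof (induction rule: inc_induct)
  case base
  show ?case by (rule recursive.ext[OF recursive.zero]) simp
next
  case (step j)
  have "recursive k (\<lambda>xs. Suc (prod_encode (xs ! j, list_encode (drop (Suc j) xs))))"
    by (intro recursive_rec1[OF rec1_Suc[OF rec1_id]] recursive_rec2[OF rec2_prod_encode]
        recursive_proj step)
  then show ?case
  proof (rule recursive.ext)
    fix xs :: "nat list"
    assume "length xs = k"
    with step have "drop j xs = xs ! j # drop (Suc j) xs"
      using Cons_nth_drop_Suc[of j xs] by simp
    then show "Suc (prod_encode (xs ! j, list_encode (drop (Suc j) xs))) = list_encode (drop j xs)"
      by simp
  qed
qed

lemma semidec_imp_RE:
  assumes "semidec P" "\<And>xs. P xs \<Longrightarrow> length xs = k"
  shows "RE k {xs. P xs}"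
proof -
  obtain F where F: "rec1 F"
    "\<And>c. (\<exists>xs. c = enc xs \<and> P xs) \<longleftrightarrow> (\<exists>y. F (prod_encode (y, c)) = 0)"
    using assms(1) unfolding semidec_def re_def by blast
  have "recursive (Suc k) (\<lambda>ys. F (prod_encode (ys ! 0, list_encode (drop 1 ys))))"
    by (intro recursive_rec1[OF F(1)] recursive_rec2[OF rec2_prod_encode] recursive_proj
        recursive_list_encode_drop) auto
  moreover have "P xs \<longleftrightarrow> (\<exists>y. F (prod_encode (y, list_encode xs)) = 0)" for xs
    using F(2)[of "enc xs"] by (auto simp: enc_eq_iff enc_nat_list[symmetric])
  ultimately show ?thesis
    unfolding RE_def using assms(2)
    by (intro exI[of _ "\<lambda>ys. F (prod_encode (ys ! 0, list_encode (drop 1 ys)))"]) auto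
qed

lemma computable_recursive1:
  assumes "recursive 1 f" "computable g"
  shows "computable (\<lambda>x. f [g x])"
proof -
  have "rec1 (\<lambda>z. f [z])"
    unfolding rec1_def by (intro recursive_comp1[OF assms(1)] recursive_proj) simp
  then have "computable (\<lambda>z. f [z])" by (rule computable_code) simp
  then show ?thesis using assms(2) by (rule computable_compose1)
qed

lemma computable_recursive2:
  assumes "recursive 2 f" "computable g" "computable h"
  shows "computable (\<lambda>x. f [g x, h x])"
proof -
  have "rec1 (\<lambda>z. f [pfst z, psnd z])"
    unfolding rec1_def
    by (intro recursive_comp2[OF assms(1)] recursive_rec1[OF rec1_pfst] recursive_rec1[OF rec1_psnd]
        recursive_proj) auto
  then have "computable (\<lambda>p. f [fst p, snd p])"
    by (rule computable_code) (simp add: enc_prod_def)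
  then show ?thesis using assms(2,3) by (rule computable_compose2)
qed

text \<open>Pairs of numbers are coded by \<open>prod_encode\<close>, so decoding is the identity on
  codes.\<close>

lemma computable_prod_decode:
  assumes "computable f"
  shows "computable (\<lambda>x. prod_decode (f x))"
proof -
  have "computable prod_decode" by (rule computable_code[OF rec1_id]) (simp add: enc_prod_def)
  then show ?thesis using assms by (rule computable_compose1)
qed

section \<open>Enumeration, parametrisation and recursion theorems\<close>

lemma acceptable_semidec:
  assumes "acceptable_enumeration n R" "computable f" "computable g"
  shows "semidec (\<lambda>x. f x \<in> R (g x))"
proof -
  have "RE (Suc n) {i # xs | i xs. xs \<in> R i}"
    using assms(1) by (simp add: acceptable_enumeration_def)
  from semidec_compose[OF RE_imp_semidec[OF this] computable_Cons[OF assms(3,2)]]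
  show ?thesis by simp
qed

lemma acceptable_index:
  assumes "acceptable_enumeration n R" "semidec P"
  shows "\<exists>c. R c = {xs. length xs = n \<and> P xs}"
proof -
  have "RE n {xs. length xs = n \<and> P xs}"
    by (intro semidec_imp_RE semidec_conj semidec_length computable_id assms(2)) simp
  then have "{xs. length xs = n \<and> P xs} \<in> range R"
    using assms(1) by (simp add: acceptable_enumeration_def)
  then show ?thesis by blast
qed

lemma acceptable_smn:
  assumes "acceptable_enumeration n R" "semidec (\<lambda>p. P (fst p) (snd p))"
  obtains s where "recursive 1 s" "\<And>x. R (s [x]) = {xs. length xs = n \<and> P x xs}"
proof -
  let ?Q = "\<lambda>ys. \<exists>x xs. ys = x # xs \<and> length xs = n \<and> P x xs"
  have "semidec ?Q"
    by (intro semidec_ex semidec_conj semidec_eq semidec_length computable_intros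
        semidec_compose2[OF assms(2)])
  then have "RE (Suc n) {ys. ?Q ys}" by (rule semidec_imp_RE) auto
  then obtain s where s: "recursive 1 s" "\<forall>x. R (s [x]) = {xs. x # xs \<in> {ys. ?Q ys}}"
    using assms(1) unfolding acceptable_enumeration_def by meson
  show thesis by (rule that[OF s(1)]) (use s(2) in simp)
qed

text \<open>
  For \<open>n \<ge> 1\<close> the enumeration of the \<open>n\<close>-ary relations also serves as a universal relation for
  the \<open>(n+1)\<close>-ary ones, the parameter \<open>w\<close> being paired with the first component.
\<close>

lemma acceptable_uniform_smn:
  assumes R: "acceptable_enumeration n R" and "n \<ge> 1"
  obtains s where "recursive 1 s"
    "\<And>P. semidec (\<lambda>p. P (fst p) (snd p)) \<Longrightarrow>
      \<exists>c. \<forall>w. R (s [prod_encode (c, w)]) = {xs. length xs = n \<and> P w xs}"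
proof -
  \<comment> \<open>Here \<open>z\<close> codes an index and the parameter \<open>w\<close>, which
    is paired with the head of the list before the indexed relation is consulted.\<close>
  let ?Q = "\<lambda>z ys. \<exists>a as. ys = a # as \<and> prod_encode (psnd z, a) # as \<in> R (pfst z)"
  have "semidec (\<lambda>p. ?Q (fst p) (snd p))"
    by (intro semidec_ex semidec_conj semidec_eq acceptable_semidec[OF R]
        computable_prod_decode computable_intros)
  from acceptable_smn[OF R this]
  obtain s where s: "recursive 1 s" "\<And>z. R (s [z]) = {ys. length ys = n \<and> ?Q z ys}"
    by blast
  have "\<exists>c. \<forall>w. R (s [prod_encode (c, w)]) = {xs. length xs = n \<and> P w xs}"
    if P: "semidec (\<lambda>p. P (fst p) (snd p))" for P
  proof -
    have "semidec (\<lambda>ys. \<exists>w a as. ys = prod_encode (w, a) # as \<and> P w (a # as))"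
      by (intro semidec_ex semidec_conj semidec_eq computable_intros semidec_compose2[OF P])
    from acceptable_index[OF R this] obtain c
      where c: "R c = {ys. length ys = n \<and> (\<exists>w a as. ys = prod_encode (w, a) # as \<and> P w (a # as))}"
      by blast
    have "R (s [prod_encode (c, w)]) = {xs. length xs = n \<and> P w xs}" for w
      using \<open>n \<ge> 1\<close> by (auto simp: s(2) c neq_Nil_conv Suc_le_length_iff)
    then show ?thesis by blast
  qed
  with s(1) that show thesis by blast
qed

text \<open>Both relations get indices \<open>s [prod_encode (c, w)]\<close>, recursive in
  \<open>c\<close> and \<open>w\<close>, so their definitions may use the two indices that can be
  read off from \<open>w\<close>. Putting \<open>(a, b)\<close> into \<open>w\<close> makes these
  the indices of the relations themselves.\<close>

lemma double_recursion:
  assumes R: "acceptable_enumeration n R" and "n \<ge> 1"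
    and P: "semidec (\<lambda>p. P (fst p) (snd p))" and Q: "semidec (\<lambda>p. Q (fst p) (snd p))"
  obtains u v where "recursive 2 u" "recursive 2 v"
    "\<And>i j. R (u [i, j]) = {xs. length xs = n \<and> P ((u [i, j], v [i, j]), (i, j)) xs}"
    "\<And>i j. R (v [i, j]) = {xs. length xs = n \<and> Q ((u [i, j], v [i, j]), (i, j)) xs}"
proof -
  obtain s where s: "recursive 1 s"
    "\<And>P. semidec (\<lambda>p. P (fst p) (snd p)) \<Longrightarrow>
      \<exists>c. \<forall>w. R (s [prod_encode (c, w)]) = {xs. length xs = n \<and> P w xs}"
    by (rule acceptable_uniform_smn[OF R \<open>n \<ge> 1\<close>]) blast
  txt \<open>Here \<open>w\<close> is to be \<open>((a, b), (i, j))\<close>, with \<open>a\<close> and \<open>b\<close> the indices found below for the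
    relations that themselves refer to \<open>d\<close>.\<close>
  define d where "d w = ((s [prod_encode (pfst (pfst w), w)], s [prod_encode (psnd (pfst w), w)]),
      prod_decode (psnd w))" for w
  have d: "computable d"
    unfolding d_def
    by (intro computable_intros computable_recursive1[OF s(1)] computable_prod_decode)
  have "semidec (\<lambda>p. P (d (fst p)) (snd p))"
    by (intro semidec_compose2[OF P] computable_compose1[OF d] computable_intros)
  from s(2)[OF this] obtain a
    where a: "\<And>w. R (s [prod_encode (a, w)]) = {xs. length xs = n \<and> P (d w) xs}"
    by blast
  have "semidec (\<lambda>p. Q (d (fst p)) (snd p))"
    by (intro semidec_compose2[OF Q] computable_compose1[OF d] computable_intros)
  from s(2)[OF this] obtain b
    where b: "\<And>w. R (s [prod_encode (b, w)]) = {xs. length xs = n \<and> Q (d w) xs}"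
    by blast
  define w where "w xs = prod_encode (prod_encode (a, b), prod_encode (xs ! 0, xs ! 1))"
    for xs :: "nat list"
  define u where "u xs = s [prod_encode (a, w xs)]" for xs
  define v where "v xs = s [prod_encode (b, w xs)]" for xs
  \<comment> \<open>The self-reference closes: at this \<open>w\<close>, the indices computed by
    \<open>d\<close> are \<open>u [i, j]\<close> and \<open>v [i, j]\<close>.\<close>
  have dw: "d (w [i, j]) = ((u [i, j], v [i, j]), (i, j))" for i j
    by (simp add: d_def u_def v_def w_def)
  have "recursive 2 u" "recursive 2 v"
    unfolding u_def v_def w_def
    by (intro recursive_comp1[OF s(1)] recursive_rec2[OF rec2_prod_encode] recursive_const
        recursive_proj; simp)+
  moreover have "R (u [i, j]) = {xs. length xs = n \<and> P ((u [i, j], v [i, j]), (i, j)) xs}"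
    "R (v [i, j]) = {xs. length xs = n \<and> Q ((u [i, j], v [i, j]), (i, j)) xs}" for i j
    using a[of "w [i, j]"] b[of "w [i, j]"] by (simp_all only: dw u_def[symmetric] v_def[symmetric])
  ultimately show thesis by (rule that)
qed


section \<open>Exact separation\<close>

theorem theorem5p2:
  fixes T :: thy and n :: nat and R :: "nat \<Rightarrow> nat list set"
  assumes "RE_theory T" and "consistent T" and "n \<ge> 1"
    and "acceptable_enumeration n R"
    and "effectively_Rosser R n T"
  shows "effectively_exact_Rosser R n T"
proof -
  obtain I f where I: "admissible I T" and f: "recursive 2 f"
    and sep: "\<And>i j. \<exists>p. f [i, j] = fm_code p \<and> strongly_separates T I n p (R i - R j) (R j - R i)"
    using assms(5) unfolding effectively_Rosser_def by blast
  have "RE 1 {[fm_code p] | p. p \<in> axioms T}"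
    using assms(1) by (simp add: RE_theory_def)
  \<comment> \<open>Composition with the map from \<open>p\<close> to the one-entry list of its code
    turns an RE set of codes into a semidecidable set of formulas.\<close>
  from semidec_compose[OF RE_imp_semidec[OF this] computable_Cons[OF computable_enc computable_const],
      OF computable_id]
  have "semidec (\<lambda>p :: fm. p \<in> axioms T)"
    by (rule semidec_cong) (auto simp: enc_fm_def inj_eq[OF inj_fm_code])
  then have pos: "semidec (\<lambda>p. T \<turnstile> p)"
    by (rule semidec_derivable)
  have neg: "semidec (\<lambda>p. T \<turnstile> Neg p)"
    by (intro semidec_compose[OF pos] computable_Imp computable_const computable_id)
  \<comment> \<open>One form for both relations: \<open>q\<close> is
    \<open>((u, v), (i, j))\<close>. Refutability with \<open>fst\<close> will give
    \<open>R (u [i, j])\<close>, provability with \<open>snd\<close> will give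
    \<open>R (v [i, j])\<close>.\<close>
  define P where "P D k q xs \<longleftrightarrow> xs \<in> R (k (snd q)) \<or>
      (\<exists>p. f [fst (fst q), snd (fst q)] = enc p \<and> length xs = n \<and> D (at_numerals I p xs))"
    for D :: "fm \<Rightarrow> bool" and k and q :: "(nat \<times> nat) \<times> (nat \<times> nat)" and xs
  have P: "semidec (\<lambda>p. P D k (fst p) (snd p))" if D: "semidec D" and k: "computable k" for D k
    unfolding P_def
    by (intro semidec_disj semidec_ex semidec_conj[OF semidec_eq] acceptable_semidec[OF assms(4)]
        semidec_at_numerals[OF D] computable_recursive2[OF f] computable_compose1[OF k]
        computable_intros)
  obtain u v where uv: "recursive 2 u" "recursive 2 v"
    "\<And>i j. R (u [i, j]) = {xs. length xs = n \<and> P (\<lambda>p. T \<turnstile> Neg p) fst ((u [i, j], v [i, j]), i, j) xs}"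
    "\<And>i j. R (v [i, j]) = {xs. length xs = n \<and> P (\<lambda>p. T \<turnstile> p) snd ((u [i, j], v [i, j]), i, j) xs}"
  proof (rule double_recursion[OF assms(4,3) P[OF neg computable_fst[OF computable_id]]
        P[OF pos computable_snd[OF computable_id]]], goal_cases)
    case (1 u v)
    show ?case by (rule 1(1)[OF 1(2-5)])
  qed
  define g where "g xs = f [u xs, v xs]" for xs
  have g: "recursive 2 g"
    unfolding g_def by (rule recursive_comp2[OF f uv(1,2)])
  have "\<exists>p. g [i, j] = fm_code p \<and> exactly_separates T I n p (R i) (R j)"
    if disj: "R i \<inter> R j = {}" for i j
  proof -
    obtain p where p: "f [u [i, j], v [i, j]] = fm_code p"
      and sp: "strongly_separates T I n p (R (u [i, j]) - R (v [i, j])) (R (v [i, j]) - R (u [i, j]))"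
      using sep by blast
    \<comment> \<open>A code determines its formula, so the existential quantifier in
      \<open>P\<close> can only pick \<open>p\<close>.\<close>
    have u: "as \<in> R (u [i, j]) \<longleftrightarrow> as \<in> R i \<or> T \<turnstile> Neg (at_numerals I p as)"
      and v: "as \<in> R (v [i, j]) \<longleftrightarrow> as \<in> R j \<or> T \<turnstile> at_numerals I p as"
      if "length as = n" for as
      using that by (auto simp: uv(3,4) P_def p enc_fm_def inj_eq[OF inj_fm_code])
    have cons: "\<not> (T \<turnstile> q \<and> T \<turnstile> Neg q)" for q
      using assms(2) derivable.mp[of "axioms T" q Bot] unfolding consistent_def by blast
    \<comment> \<open>Disjointness enters here: a list in \<open>R i\<close> lies outside
      \<open>R j\<close>, so it can belong to \<open>R (v [i, j])\<close> only through provability,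
      and likewise with the roles exchanged.\<close>
    have "as \<in> R i \<longleftrightarrow> T \<turnstile> at_numerals I p as" "as \<in> R j \<longleftrightarrow> T \<turnstile> Neg (at_numerals I p as)"
      if "length as = n" for as
      using sp u[OF that] v[OF that] cons[of "at_numerals I p as"] disj that
      unfolding strongly_separates_def by blast+
    with sp have "exactly_separates T I n p (R i) (R j)"
      unfolding strongly_separates_def exactly_separates_def by blast
    with p show ?thesis by (auto simp: g_def)
  qed
  with I g show ?thesis
    unfolding effectively_exact_Rosser_def by blast
qed

end
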